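(* Let $W^T_{n,d}$ denote the maximum Wiener index among all trees of order $n$ and diameter $d$. When $d$ is even, as $n\to\infty$, $$\frac d2 n^2-\left(\frac{29}{60}d^{3/2}+o(d^{3/2})\right)n^{3/2}+O_d(n)\ \le\ W^T_{n,d}\ \le\ \frac d2 n^2-\left(\frac{\sqrt2}{3}d^{3/2}+O(\sqrt d)\right)n^{3/2}+O_d(n),$$ while when $d$ is odd, as $n\to\infty$, $$\frac{d-0.5}{2} n^2-\left(\frac{29}{60}d^{3/2}+o(d^{3/2})\right)n^{3/2}+O_d(n)\ \le\ W^T_{n,d}\ \le\ \frac{d-0.5}{2} n^2-\left(\frac{\sqrt2}{3}d^{3/2}+O(\sqrt d)\right)n^{3/2}+O_d(n).$$
   Context: Trees are finite; the Wiener index is the sum of distances over all unordered pairs of distinct vertices. The terms $o(d^{3/2})$ and $O(\sqrt d)$ are functions of $d$ only, understood as $d\to\infty$ (for $O(\sqrt d)$: bounded in absolute value by $M\sqrt d$ for a constant $M$ and all large $d$; for $o(d^{3/2})$: ratio to $d^{3/2}$ tends to $0$). The term $O_d(n)$ means a quantity bounded in absolute value by $M(d)n$ for all $n\ge n_0(d)$, where the constants $M(d),n_0(d)$ may depend on $d$. *)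

theory Defs
  imports
    "Graph_Theory.Graph_Theory"
    "HOL-Library.Landau_Symbols"
begin

text \<open>
  A finite simple graph is a finite, loop-free, symmetric digraph without parallel arcs
  (locale \<^locale>\<open>pair_graph\<close>). In such a digraph a walk \<open>u, v, u\<close> along a single
  edge counts as a \<^const>\<open>pre_digraph.cycle\<close> of length 2, so \<^const>\<open>forest\<close> and
  \<^const>\<open>tree\<close> from the library do not describe undirected trees; the cycles of the
  undirected graph are exactly those of length at least 3.
\<close>

definition is_tree :: "'a pair_pre_digraph \<Rightarrow> bool" where
  "is_tree G \<longleftrightarrow> pair_graph G \<and> Digraph_Component.connected (with_proj G) \<and>
     \<not> (\<exists>p. pre_digraph.cycle (with_proj G) p \<and> 3 \<le> length p)"

definition gdist :: "'a pair_pre_digraph \<Rightarrow> 'a \<Rightarrow> 'a \<Rightarrow> nat" where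
  "gdist G u v = (LEAST k. \<exists>p. pre_digraph.awalk (with_proj G) u p v \<and> length p = k)"

definition gdiameter :: "'a pair_pre_digraph \<Rightarrow> nat" where
  "gdiameter G = Max {gdist G u v | u v. u \<in> pverts G \<and> v \<in> pverts G}"

text \<open>The condition \<open>u < v\<close> picks every unordered pair of distinct vertices exactly once.\<close>

definition wiener_index :: "'a::linorder pair_pre_digraph \<Rightarrow> nat" where
  "wiener_index G = (\<Sum>u\<in>pverts G. \<Sum>v\<in>{v \<in> pverts G. u < v}. gdist G u v)"

text \<open>
  Up to isomorphism every finite tree has its vertices in \<^typ>\<open>nat\<close>. If there is no tree of
  order \<open>n\<close> and diameter \<open>d\<close>, the value is unspecified; for \<open>2 \<le> d < n\<close> such trees exist.
\<close>

definition max_wiener_index :: "nat \<Rightarrow> nat \<Rightarrow> nat" where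
  "max_wiener_index n d =
     Max {wiener_index G | G :: nat pair_pre_digraph.
            is_tree G \<and> card (pverts G) = n \<and> gdiameter G = d}"

text \<open>The maximum is taken over a finite set.\<close>

lemma finite_wiener_indices:
  "finite {wiener_index G | G :: nat pair_pre_digraph.
            is_tree G \<and> card (pverts G) = n \<and> gdiameter G = d}"
proof (rule finite_subset)
  show "{wiener_index G | G :: nat pair_pre_digraph.
            is_tree G \<and> card (pverts G) = n \<and> gdiameter G = d} \<subseteq> {..n * (n * d)}"
  proof
    fix w
    assume "w \<in> {wiener_index G | G :: nat pair_pre_digraph.
            is_tree G \<and> card (pverts G) = n \<and> gdiameter G = d}"
    then obtain G :: "nat pair_pre_digraph"
      where G: "is_tree G" and eq: "w = wiener_index G" "card (pverts G) = n" "gdiameter G = d"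
      by blast
    have fin: "finite (pverts G)"
      using G by (auto simp: is_tree_def dest: pair_fin_digraph.pair_finite_verts
          pair_digraph.axioms(1) pair_graph.axioms(1))
    have "finite ((\<lambda>(u, v). gdist G u v) ` (pverts G \<times> pverts G))"
      using fin by blast
    moreover have "{gdist G u v | u v. u \<in> pverts G \<and> v \<in> pverts G}
        = (\<lambda>(u, v). gdist G u v) ` (pverts G \<times> pverts G)" by auto
    ultimately have le: "gdist G u v \<le> gdiameter G" if "u \<in> pverts G" "v \<in> pverts G" for u v
      unfolding gdiameter_def using that by (intro Max_ge) auto
    have "(\<Sum>v\<in>{v \<in> pverts G. u < v}. gdist G u v) \<le> card (pverts G) * gdiameter G"
      if u: "u \<in> pverts G" for u
    proof -
      have "(\<Sum>v\<in>{v \<in> pverts G. u < v}. gdist G u v) \<le> (\<Sum>v\<in>pverts G. gdist G u v)"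
        using fin by (intro sum_mono2) auto
      also have "\<dots> \<le> of_nat (card (pverts G)) * gdiameter G"
        using le u by (intro sum_bounded_above) auto
      finally show ?thesis by simp
    qed
    then have "wiener_index G \<le> of_nat (card (pverts G)) * (card (pverts G) * gdiameter G)"
      unfolding wiener_index_def by (intro sum_bounded_above) auto
    then show "w \<in> {..n * (n * d)}"
      using eq by simp
  qed
qed simp

end

(*
  Write d = 2r + e with e in {0, 1}. A tree of diameter d has a center: one vertex (e = 0) or two
  adjacent vertices (e = 1) within distance r of which every vertex lies. Rooting the tree there, the
  distance of u and v is dep u + dep v, plus e if the roots differ, minus twice the depth of the
  lowest common ancestor. Summing over all pairs, the loss against (r + e/4) n^2 is, up to O(n), the
  sum over the levels 0 < i < r of n k_i (r - i) plus the sum of the squares of the numbers of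
  descendants, where k_i is the number of vertices at depth i. By convexity the squares add up to about
  n^2 / k_i at least, so that each level loses at least 2 n sqrt (n (r - i)); this is the upper bound.
  If the descendants are distributed evenly, convexity is sharp. The optimal k_i = sqrt (n / (r - i))
  cannot be realised by an integral branching, but with k_i about (6/5) sqrt (n / r) up to depth 2r/3
  and twice that number below, the loss is (49/36) (r n)^(3/2) + O(n), which is less than
  (29/60) (d n)^(3/2) + O(n). Hence no o(d^(3/2)) correction is needed in the lower bound.
*)
theory Submission
  imports Defs
begin

section \<open>Distances in trees and the center\<close>

text \<open>The level sizes are made to divide one another so that descendants can be split evenly;
  hence the optimal profile is replaced by a step function with one doubling. With
  \<open>a sqrt (n / r)\<close> vertices per level up to depth \<open>c r\<close> and twice as many
  below, the loss is to leading order \<open>(r n)^(3/2)\<close> times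
  \<open>a (1 + (1 - c)^2) / 2 + (1 + c) / (2 a)\<close>. The best \<open>a\<close> for given
  \<open>c\<close> turns this into \<open>sqrt (2 - c^2 + c^3)\<close>, which is least at
  \<open>c = 2/3\<close>, where \<open>a = sqrt (3/2)\<close>. The constant 6/5 is a rational number
  close to it, and the two parts become 2/3 and 25/36. In the upper bound the level sizes are
  unknown: a tree may have many vertices of small depth, and then the levels below them have fewer
  than n descendants to share. Such vertices are costly in themselves, so their own depth deficit is
  made to pay for what they take away from lower levels.\<close>

lemma awalk_iff_relpow:
  "(\<exists>p. pre_digraph.awalk (with_proj G) u p v \<and> length p = k) \<longleftrightarrow>
     u \<in> pverts G \<and> (u, v) \<in> parcs G ^^ k"
proof -
  have "(\<exists>p. set p \<subseteq> parcs G \<and> pcas u p v \<and> length p = k) \<longleftrightarrow> (u, v) \<in> parcs G ^^ k"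
  proof (induction k arbitrary: u)
    case 0
    then show ?case by auto
  next
    case (Suc k)
    have "(\<exists>p. set p \<subseteq> parcs G \<and> pcas u p v \<and> length p = Suc k) \<longleftrightarrow>
        (\<exists>w p. (u, w) \<in> parcs G \<and> set p \<subseteq> parcs G \<and> pcas w p v \<and> length p = k)"
      (is "?L \<longleftrightarrow> ?R")
    proof
      assume ?L
      then show ?R by (fastforce simp: length_Suc_conv)
    next
      assume ?R
      then obtain w p where "(u, w) \<in> parcs G" "set p \<subseteq> parcs G" "pcas w p v" "length p = k"
        by blast
      then show ?L by (intro exI[of _ "(u, w) # p"]) auto
    qed
    also have "\<dots> \<longleftrightarrow> (\<exists>w. (u, w) \<in> parcs G \<and> (w, v) \<in> parcs G ^^ k)"
      using Suc.IH by blast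
    also have "\<dots> \<longleftrightarrow> (u, v) \<in> parcs G ^^ Suc k"
      by (meson relpow_Suc_D2 relpow_Suc_I2)
    finally show ?case .
  qed
  then show ?thesis
    by (auto simp: pre_digraph.awalk_def cas_with_proj_eq)
qed

lemma gdist_eq_Least:
  assumes "u \<in> pverts G"
  shows "gdist G u v = (LEAST k. (u, v) \<in> parcs G ^^ k)"
  using assms by (simp add: gdist_def awalk_iff_relpow)

lemma gdist_le:
  assumes "u \<in> pverts G" "(u, v) \<in> parcs G ^^ k"
  shows "gdist G u v \<le> k"
  using assms by (simp add: gdist_eq_Least Least_le)

text \<open>Zipping a vertex list with its tail gives the arcs along it; this leads from vertex
  lists to the arc lists on which cycles are defined.\<close>

lemma pcas_zip:
  "pcas x (zip (x # p) p) (last (x # p))"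
  by (induction p arbitrary: x) auto

lemma pawalk_verts_zip:
  "pawalk_verts x (zip (x # p) p) = x # p"
  by (induction p arbitrary: x) auto

lemma set_zip_subset_if_successively:
  "successively (\<lambda>a b. (a, b) \<in> E) (x # p) \<Longrightarrow> set (zip (x # p) p) \<subseteq> E"
  by (induction p arbitrary: x) auto

text \<open>The base point stands in front and again as \<open>last p\<close>, so distinctness is
  asked of \<open>p\<close> alone.\<close>

lemma cycle_of_vertex_list:
  assumes "x \<in> pverts G" "successively (\<lambda>a b. (a, b) \<in> parcs G) (x # p)"
    and "distinct p" "p \<noteq> []" "last p = x"
  shows "\<exists>c. pre_digraph.cycle (with_proj G) c \<and> length c = length p"
proof (intro exI conjI)
  show "pre_digraph.cycle (with_proj G) (zip (x # p) p)"
    unfolding pre_digraph.cycle_def pre_digraph.awalk_def cas_with_proj_eq awalk_verts_with_proj_eq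
    using assms pcas_zip[of x p] set_zip_subset_if_successively[OF assms(2)]
    by (intro exI[of _ x]) (auto simp: pawalk_verts_zip zip_eq_Nil_iff)
qed simp

section \<open>The metric of a connected graph\<close>

locale connected_graph =
  fixes G :: "'a pair_pre_digraph"
  assumes graph: "pair_graph G"
    and conn: "Digraph_Component.connected (with_proj G)"
begin

lemma finite_verts: "finite (pverts G)"
  using graph pair_graph.axioms(1) pair_digraph.axioms(1) pair_fin_digraph.pair_finite_verts
  by blast

lemma arcD: assumes "(u, v) \<in> parcs G"
  shows "u \<in> pverts G" "v \<in> pverts G" "(v, u) \<in> parcs G" "u \<noteq> v"
proof -
  interpret pair_graph G by (rule graph)
  show "u \<in> pverts G" "v \<in> pverts G" using assms by (auto dest: in_arcsD1 in_arcsD2)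
  show "(v, u) \<in> parcs G" using assms by (rule arcs_symmetric)
  show "u \<noteq> v" using assms by (rule no_loops')
qed

lemma verts_nonempty: "pverts G \<noteq> {}"
  using conn by (auto simp: connected_conv)

lemma relpow_exists:
  assumes "u \<in> pverts G" "v \<in> pverts G"
  shows "\<exists>k. (u, v) \<in> parcs G ^^ k"
proof -
  have "(parcs G)\<^sup>s = parcs G"
    using arcD by (auto simp: symcl_def)
  then have "(u, v) \<in> rtrancl_on (pverts G) (parcs G)"
    using conn assms by (auto simp: connected_conv)
  then have "(u, v) \<in> (parcs G)\<^sup>*"
    by (rule rtrancl_on_rtranclI)
  then show ?thesis
    by (auto simp: rtrancl_power)
qed

text \<open>Connectedness makes the set under \<open>LEAST\<close> nonempty, so the minimum is
  attained.\<close>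

lemma gdist_relpow:
  assumes "u \<in> pverts G" "v \<in> pverts G"
  shows "(u, v) \<in> parcs G ^^ gdist G u v"
  unfolding gdist_eq_Least[OF assms(1)] using relpow_exists[OF assms] by (rule LeastI_ex)

lemma relpow_sym: "(u, v) \<in> parcs G ^^ k \<Longrightarrow> (v, u) \<in> parcs G ^^ k"
proof (induction k arbitrary: u)
  case (Suc k)
  then obtain w where "(u, w) \<in> parcs G" "(w, v) \<in> parcs G ^^ k"
    by (meson relpow_Suc_D2)
  then show ?case using Suc.IH arcD(3) by (auto intro: relpow_Suc_I)
qed auto

lemma gdist_sym:
  assumes "u \<in> pverts G" "v \<in> pverts G"
  shows "gdist G u v = gdist G v u"
  using gdist_le[OF assms(1) relpow_sym[OF gdist_relpow[OF assms(2,1)]]]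
    gdist_le[OF assms(2) relpow_sym[OF gdist_relpow[OF assms]]] by simp

lemma gdist_self [simp]: "u \<in> pverts G \<Longrightarrow> gdist G u u = 0"
  using gdist_le[of u G u 0] by simp

lemma gdist_eq_0_iff:
  assumes "u \<in> pverts G" "v \<in> pverts G"
  shows "gdist G u v = 0 \<longleftrightarrow> u = v"
proof
  assume "gdist G u v = 0"
  then show "u = v" using gdist_relpow[OF assms] by simp
qed (use assms in simp)

lemma gdist_triangle:
  assumes "u \<in> pverts G" "v \<in> pverts G" "w \<in> pverts G"
  shows "gdist G u w \<le> gdist G u v + gdist G v w"
  using assms by (intro gdist_le relpow_trans[OF gdist_relpow gdist_relpow]) auto

lemma gdist_arc_le:
  assumes "u \<in> pverts G" "(v, w) \<in> parcs G"
  shows "gdist G u w \<le> Suc (gdist G u v)"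
  using assms arcD[OF assms(2)] by (intro gdist_le relpow_Suc_I[OF gdist_relpow]) auto

lemma gdist_pred:
  assumes "u \<in> pverts G" "v \<in> pverts G" "gdist G u v = Suc k"
  obtains w where "(w, v) \<in> parcs G" "gdist G u w = k"
proof -
  obtain w where w: "(u, w) \<in> parcs G ^^ k" "(w, v) \<in> parcs G"
    using gdist_relpow[OF assms(1,2)] assms(3) by auto
  have "gdist G u w = k"
    using gdist_le[OF assms(1) w(1)] gdist_arc_le[OF assms(1) w(2)] assms(3) by simp
  then show ?thesis using that w by blast
qed

text \<open>Counting arcs from either end bounds the two distances of \<open>f i\<close> by
  \<open>i\<close> and \<open>gdist G u v - i\<close>; the triangle inequality forces equality in
  both.\<close>

lemma geodesic:
  assumes "u \<in> pverts G" "v \<in> pverts G"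
  obtains f where "f 0 = u" "f (gdist G u v) = v"
    "\<And>i. i < gdist G u v \<Longrightarrow> (f i, f (Suc i)) \<in> parcs G"
    "\<And>i. i \<le> gdist G u v \<Longrightarrow> f i \<in> pverts G"
    "\<And>i. i \<le> gdist G u v \<Longrightarrow> gdist G u (f i) = i"
    "\<And>i. i \<le> gdist G u v \<Longrightarrow> gdist G (f i) v = gdist G u v - i"
proof -
  let ?d = "gdist G u v"
  obtain f where f: "f 0 = u" "f ?d = v" "\<And>i. i < ?d \<Longrightarrow> (f i, f (Suc i)) \<in> parcs G"
    using gdist_relpow[OF assms] unfolding relpow_fun_conv by blast
  have V: "f i \<in> pverts G" if "i \<le> ?d" for i
    using that f assms arcD by (metis le_neq_implies_less)
  have le1: "gdist G u (f i) \<le> i" if "i \<le> ?d" for i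
    using that
  proof (induction i)
    case (Suc i)
    then show ?case using gdist_arc_le[OF assms(1) f(3)[of i]] by simp
  qed (use f assms in simp)
  have le2: "gdist G (f (?d - i)) v \<le> i" if "i \<le> ?d" for i
    using that
  proof (induction i)
    case (Suc i)
    then have "(f (?d - Suc i), f (?d - i)) \<in> parcs G"
      using f(3)[of "?d - Suc i"] by (simp add: Suc_diff_Suc)
    then have "gdist G v (f (?d - Suc i)) \<le> Suc (gdist G v (f (?d - i)))"
      using arcD(3) assms(2) by (blast intro: gdist_arc_le)
    then show ?case using Suc V[of "?d - Suc i"] V[of "?d - i"] assms gdist_sym by simp
  qed (use f assms in simp)
  have "gdist G u (f i) = i \<and> gdist G (f i) v = ?d - i" if "i \<le> ?d" for i
  proof -
    have "gdist G (f i) v \<le> ?d - i" using le2[of "?d - i"] that by simp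
    then show ?thesis
      using le1[OF that] that gdist_triangle[OF assms(1) V[OF that] assms(2)] by linarith
  qed
  then show ?thesis using that f V by blast
qed

end

section \<open>Paths in trees and the center\<close>

locale tree_graph = connected_graph +
  assumes acyclic: "\<not> (\<exists>p. pre_digraph.cycle (with_proj G) p \<and> 3 \<le> length p)"
begin

text \<open>
  Two vertices at distance \<open>k\<close> from \<open>v\<close> that are joined by a path above that level would, after
  descending towards \<open>v\<close> from both ends until the descents meet, give a cycle.
\<close>
lemma no_arch:
  assumes v: "v \<in> pverts G"
  shows "\<lbrakk>successively (\<lambda>a b. (a, b) \<in> parcs G) (a # q @ [b]); distinct (a # q @ [b]);
      gdist G v a = k; gdist G v b = k; \<forall>x\<in>set q. k < gdist G v x;
      a \<in> pverts G; b \<in> pverts G\<rbrakk> \<Longrightarrow> False"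
proof (induction k arbitrary: a q b)
  case 0
  then show ?case using gdist_eq_0_iff v by auto
next
  case (Suc k)
  obtain a' where a': "(a', a) \<in> parcs G" "gdist G v a' = k"
    using gdist_pred v Suc.prems by metis
  obtain b' where b': "(b', b) \<in> parcs G" "gdist G v b' = k"
    using gdist_pred v Suc.prems by metis
  have new: "a' \<notin> set (a # q @ [b])" "b' \<notin> set (a # q @ [b])"
    using Suc.prems a' b' by auto
  have walk: "successively (\<lambda>a b. (a, b) \<in> parcs G) (a' # (a # q @ [b]) @ [b'])"
  proof -
    have "successively (\<lambda>a b. (a, b) \<in> parcs G) ((a # q @ [b]) @ [b'])"
      unfolding successively_append_iff using Suc.prems(1) arcD(3)[OF b'(1)] by simp
    then show ?thesis using a' by simp
  qed
  show ?case
  proof (cases "a' = b'")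
    case True
    \<comment> \<open>The closed walk passes through \<open>a\<close>, \<open>b\<close> and the
      meeting point, which are distinct, so its length is at least 3.\<close>
    have "\<exists>c. pre_digraph.cycle (with_proj G) c \<and> length c = length ((a # q @ [b]) @ [b'])"
      using walk new Suc.prems True arcD[OF a'(1)] by (intro cycle_of_vertex_list) auto
    then show False using acyclic by fastforce
  next
    case False
    have "a' \<in> pverts G" "b' \<in> pverts G" using a' b' arcD by auto
    moreover have "\<forall>x\<in>set (a # q @ [b]). k < gdist G v x"
      using Suc.prems by auto
    ultimately show False
      using Suc.IH[of a' "a # q @ [b]" b'] walk new False Suc.prems a' b' by auto
  qed
qed

text \<open>An arc between vertices of the same level would be an arch with empty interior. In other
  words, trees are bipartite.\<close>

lemma gdist_arc_neq:
  assumes "v \<in> pverts G" "(a, b) \<in> parcs G"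
  shows "gdist G v a \<noteq> gdist G v b"
  using no_arch[OF assms(1), of a "[]" b] assms arcD[OF assms(2)] by auto

text \<open>Both neighbours lie on the level just below that of \<open>c\<close>, so if they
  differed, \<open>c\<close> would be the interior of an arch.\<close>

lemma nearer_neighbour_unique:
  assumes "v \<in> pverts G" "(c, a) \<in> parcs G" "(c, b) \<in> parcs G"
    and "gdist G v a \<le> gdist G v c" "gdist G v b \<le> gdist G v c"
  shows "a = b"
proof (rule ccontr)
  assume "a \<noteq> b"
  have "gdist G v a < gdist G v c" "gdist G v b < gdist G v c"
    using assms gdist_arc_neq by (metis le_neq_implies_less)+
  moreover have "gdist G v c \<le> Suc (gdist G v a)" "gdist G v c \<le> Suc (gdist G v b)"
    using assms arcD(3) gdist_arc_le by blast+
  ultimately show False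
    using no_arch[OF assms(1), of a "[c]" b "gdist G v a"] \<open>a \<noteq> b\<close> assms(3)
      arcD[OF assms(2)] arcD[OF assms(3)] by simp
qed

text \<open>A walk that has moved away from \<open>v\<close> cannot turn without backtracking: the
  vertex it came from is the only neighbour that is not farther from \<open>v\<close>.\<close>

lemma gdist_grows:
  assumes v: "v \<in> pverts G"
    and walk: "\<And>i. i < m \<Longrightarrow> (f i, f (Suc i)) \<in> parcs G"
    and nb: "\<And>i. Suc i < m \<Longrightarrow> f (Suc (Suc i)) \<noteq> f i"
    and first: "gdist G v (f 1) = Suc (gdist G v (f 0))"
  shows "1 \<le> m \<Longrightarrow> gdist G v (f m) = gdist G v (f 0) + m"
proof -
  have "gdist G v (f (Suc i)) = Suc (gdist G v (f i))" if "i < m" for i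
    using that
  proof (induction i)
    case (Suc i)
    have "\<not> gdist G v (f (Suc (Suc i))) \<le> gdist G v (f (Suc i))"
      using nearer_neighbour_unique[OF v, of "f (Suc i)" "f (Suc (Suc i))" "f i"]
        walk[of i] walk[of "Suc i"] nb[of i] Suc arcD(3) by fastforce
    then show ?case using gdist_arc_le[OF v walk[of "Suc i"]] Suc.prems by simp
  qed (use first in simp)
  then have *: "i \<le> m \<Longrightarrow> gdist G v (f i) = gdist G v (f 0) + i" for i
    by (induction i) auto
  show "gdist G v (f m) = gdist G v (f 0) + m" by (rule *) simp
qed

text \<open>A vertex off the geodesic is reached from an inner vertex of it by leaving the geodesic, so
  its distance to one of the two ends is realised through that inner vertex.\<close>
lemma gdist_through_inner_vertex:
  assumes v: "v \<in> pverts G"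
    and f: "\<And>i. i < d \<Longrightarrow> (f i, f (Suc i)) \<in> parcs G"
    and nb: "\<And>i. Suc i < d \<Longrightarrow> f (Suc (Suc i)) \<noteq> f i"
    and i: "0 < i" "i < d"
  shows "gdist G v (f (Suc i)) = Suc (gdist G v (f i)) \<and> gdist G v (f d) = gdist G v (f i) + (d - i)
    \<or> Suc (gdist G v (f (Suc i))) = gdist G v (f i) \<and> gdist G v (f 0) = gdist G v (f i) + i"
proof (cases "gdist G v (f (Suc i)) \<le> gdist G v (f i)")
  case False
  then have *: "gdist G v (f (Suc i)) = Suc (gdist G v (f i))"
    using gdist_arc_le[OF v f[OF i(2)]] by simp
  have "gdist G v (f (i + (d - i))) = gdist G v (f (i + 0)) + (d - i)"
    using i f nb * by (intro gdist_grows[OF v]) auto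
  then show ?thesis using * i by simp
next
  case True
  have arcs: "(f i, f (Suc i)) \<in> parcs G" "(f i, f (i - 1)) \<in> parcs G"
    using f[of i] f[of "i - 1"] i arcD(3) by auto
  have "\<not> gdist G v (f (i - 1)) \<le> gdist G v (f i)"
    using nearer_neighbour_unique[OF v arcs True] nb[of "i - 1"] i by auto
  then have *: "gdist G v (f (i - 1)) = Suc (gdist G v (f i))"
    using gdist_arc_le[OF v arcs(2)] by simp
  \<comment> \<open>The geodesic is run backwards from \<open>f i\<close>; its \<open>j\<close>-th
    vertex is \<open>f (i - j)\<close>.\<close>
  have "gdist G v (f (i - i)) = gdist G v (f (i - 0)) + i"
  proof (rule gdist_grows[OF v])
    show "(f (i - j), f (i - Suc j)) \<in> parcs G" if "j < i" for j
      using f[of "i - Suc j"] that i arcD(3) by (simp add: Suc_diff_Suc)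
    show "f (i - Suc (Suc j)) \<noteq> f (i - j)" if "Suc j < i" for j
      using nb[of "i - Suc (Suc j)"] that i by (simp add: Suc_diff_Suc eq_commute)
  qed (use * i in auto)
  moreover have "Suc (gdist G v (f (Suc i))) = gdist G v (f i)"
    using True gdist_arc_neq[OF v arcs(1)] gdist_arc_le[OF v arcD(3)[OF arcs(1)]] by simp
  ultimately show ?thesis by simp
qed

lemma gdist_le_diameter:
  assumes "u \<in> pverts G" "v \<in> pverts G"
  shows "gdist G u v \<le> gdiameter G"
proof -
  have "{gdist G u v | u v. u \<in> pverts G \<and> v \<in> pverts G}
      = (\<lambda>(u, v). gdist G u v) ` (pverts G \<times> pverts G)" by auto
  then show ?thesis
    unfolding gdiameter_def using assms finite_verts by (intro Max_ge) auto
qed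

lemma diametral_pair:
  obtains u v where "u \<in> pverts G" "v \<in> pverts G" "gdist G u v = gdiameter G"
proof -
  have "{gdist G u v | u v. u \<in> pverts G \<and> v \<in> pverts G}
      = (\<lambda>(u, v). gdist G u v) ` (pverts G \<times> pverts G)" by auto
  then have "gdiameter G \<in> {gdist G u v | u v. u \<in> pverts G \<and> v \<in> pverts G}"
    unfolding gdiameter_def using finite_verts verts_nonempty by (intro Max_in) auto
  then show ?thesis using that by auto
qed

text \<open>The roots are the middle vertices of a diametral path. A vertex too far from them would
  be at distance more than the diameter from an end of that path.\<close>

lemma center:
  assumes "2 \<le> gdiameter G"
  obtains Z where "Z \<subseteq> pverts G" "Z \<noteq> {}" "card Z \<le> 1 + gdiameter G mod 2"
    "\<And>y z. \<lbrakk>y \<in> Z; z \<in> Z\<rbrakk> \<Longrightarrow> gdist G y z \<le> gdiameter G mod 2"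
    "\<And>v. v \<in> pverts G \<Longrightarrow> \<exists>z\<in>Z. gdist G v z \<le> gdiameter G div 2"
proof -
  let ?d = "gdiameter G"
  define r where "r = ?d div 2"
  obtain x y where xy: "x \<in> pverts G" "y \<in> pverts G" "gdist G x y = ?d"
    by (rule diametral_pair)
  obtain f where f: "f 0 = x" "f ?d = y" "\<And>i. i < ?d \<Longrightarrow> (f i, f (Suc i)) \<in> parcs G"
    "\<And>i. i \<le> ?d \<Longrightarrow> f i \<in> pverts G" "\<And>i. i \<le> ?d \<Longrightarrow> gdist G x (f i) = i"
    using geodesic[OF xy(1,2)] xy(3) by metis
  have nb: "f (Suc (Suc i)) \<noteq> f i" if "Suc i < ?d" for i
    using f(5)[of i] f(5)[of "Suc (Suc i)"] that by auto
  have r: "0 < r" "r < ?d" using assms by (auto simp: r_def)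
  \<comment> \<open>In the second alternative with odd diameter, \<open>f r\<close> may be at
    distance \<open>r + 1\<close>; the first equation then makes \<open>f (Suc r)\<close> the root
    within distance \<open>r\<close>.\<close>
  have through: "gdist G v (f r) + (?d - r) \<le> ?d \<or>
      Suc (gdist G v (f (Suc r))) = gdist G v (f r) \<and> gdist G v (f r) + r \<le> ?d"
    if v: "v \<in> pverts G" for v
    using gdist_through_inner_vertex[where f = f and d = ?d and i = r, OF v f(3) nb r] gdist_le_diameter[OF v f(4)[of 0]]
      gdist_le_diameter[OF v f(4)[of ?d]] by auto
  show ?thesis
  proof (cases "even ?d")
    case True
    then have d: "?d = 2 * r" by (simp add: r_def)
    show ?thesis
    proof (rule that[of "{f r}"])
      show "\<exists>z\<in>{f r}. gdist G v z \<le> ?d div 2" if "v \<in> pverts G" for v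
        using through[OF that] d by auto
    qed (use f(4)[of r] r in auto)
  next
    case False
    then have d: "?d = 2 * r + 1" by (simp add: r_def)
    have V: "f r \<in> pverts G" "f (Suc r) \<in> pverts G" using f(4) r by auto
    show ?thesis
    proof (rule that[of "{f r, f (Suc r)}"])
      show "\<exists>z\<in>{f r, f (Suc r)}. gdist G v z \<le> ?d div 2" if "v \<in> pverts G" for v
        using through[OF that] d by auto
      have "gdist G (f r) (f (Suc r)) \<le> 1"
        using gdist_arc_le[OF V(1) f(3)[OF r(2)]] V by simp
      then show "gdist G a b \<le> ?d mod 2" if "a \<in> {f r, f (Suc r)}" "b \<in> {f r, f (Suc r)}" for a b
        using that V gdist_sym[OF V] d by auto
      show "card {f r, f (Suc r)} \<le> 1 + ?d mod 2"
        using d by (simp add: card_insert_if)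
    qed (use V in auto)
  qed
qed

end

lemma is_tree_iff: "is_tree G \<longleftrightarrow> tree_graph G"
  by (simp add: is_tree_def tree_graph_def connected_graph_def tree_graph_axioms_def)

section \<open>Rooted trees and the sum of their distances\<close>

text \<open>A forest given by parent pointers. Several vertices of depth 0 are allowed, so that the
  two middle vertices of a tree of odd diameter are treated alike; \<open>e\<close> is their
  intended distance and enters through \<open>tdist\<close>.\<close>

locale layered =
  fixes V :: "'a set" and dep :: "'a \<Rightarrow> nat" and par :: "'a \<Rightarrow> 'a" and r e :: nat
  assumes fin: "finite V"
    and dep_le: "v \<in> V \<Longrightarrow> dep v \<le> r"
    and par_in: "\<lbrakk>v \<in> V; 0 < dep v\<rbrakk> \<Longrightarrow> par v \<in> V"
    and dep_par: "\<lbrakk>v \<in> V; 0 < dep v\<rbrakk> \<Longrightarrow> Suc (dep (par v)) = dep v"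
begin

definition anc :: "nat \<Rightarrow> 'a \<Rightarrow> 'a" where
  "anc i v = (par ^^ (dep v - i)) v"

text \<open>The guards are there because \<open>anc i v\<close> is \<open>v\<close> itself when
  \<open>dep v < i\<close>, by truncated subtraction.\<close>

definition share :: "nat \<Rightarrow> 'a \<Rightarrow> 'a \<Rightarrow> bool" where
  "share i u v \<longleftrightarrow> i \<le> dep u \<and> i \<le> dep v \<and> anc i u = anc i v"

text \<open>
  Since the levels at which \<open>u\<close> and \<open>v\<close> have a common ancestor form an initial segment, the sum
  is the depth of their lowest common ancestor. Distinct roots are meant to be at distance \<open>e\<close>.
\<close>
definition tdist :: "'a \<Rightarrow> 'a \<Rightarrow> real" where
  "tdist u v = real (dep u) + real (dep v) + real e * (1 - of_bool (share 0 u v))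
     - 2 * (\<Sum>i=1..r. of_bool (share i u v))"

definition level :: "nat \<Rightarrow> 'a set" where
  "level i = {w \<in> V. dep w = i}"

definition desc :: "'a \<Rightarrow> 'a set" where
  "desc w = {v \<in> V. dep w \<le> dep v \<and> anc (dep w) v = w}"

text \<open>Ordered pairs, including \<open>u = v\<close>, are counted, so that the count is exactly
  a sum of squares.\<close>

definition shared :: "nat \<Rightarrow> real" where
  "shared i = (\<Sum>u\<in>V. \<Sum>v\<in>V. of_bool (share i u v))"

lemma funpow_par:
  assumes "v \<in> V" "k \<le> dep v"
  shows "(par ^^ k) v \<in> V \<and> dep ((par ^^ k) v) = dep v - k"
  using assms(2)
proof (induction k)
  case (Suc k)
  then show ?case using par_in[of "(par ^^ k) v"] dep_par[of "(par ^^ k) v"] by simp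
qed (use assms in simp)

lemma anc_in: "\<lbrakk>v \<in> V; i \<le> dep v\<rbrakk> \<Longrightarrow> anc i v \<in> V"
  and dep_anc: "\<lbrakk>v \<in> V; i \<le> dep v\<rbrakk> \<Longrightarrow> dep (anc i v) = i"
  using funpow_par[of v "dep v - i"] by (auto simp: anc_def)

lemma anc_self [simp]: "anc (dep v) v = v"
  by (simp add: anc_def)

lemma anc_par:
  assumes "v \<in> V" "i < dep v" shows "anc i (par v) = anc i v"
proof -
  have "dep v - i = Suc (dep (par v) - i)" using dep_par[of v] assms by simp
  then show ?thesis by (simp add: anc_def funpow_swap1)
qed

lemma anc_anc:
  assumes "v \<in> V" "i \<le> j" "j \<le> dep v"
  shows "anc i (anc j v) = anc i v"
proof -
  have "dep v - i = (j - i) + (dep v - j)" using assms by simp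
  then show ?thesis using dep_anc[OF assms(1,3)] by (simp add: anc_def funpow_add)
qed

lemma share_mono: "\<lbrakk>u \<in> V; v \<in> V; share j u v; i \<le> j\<rbrakk> \<Longrightarrow> share i u v"
  using anc_anc[of u i j] anc_anc[of v i j] by (auto simp: share_def)

lemma share_level_eq:
  assumes "u \<in> V" "v \<in> V" "share 0 u v"
  obtains m where "share m u v" "(\<Sum>i=1..r. of_bool (share i u v) :: real) = real m"
proof -
  \<comment> \<open>The depth of the lowest common ancestor.\<close>
  define m where "m = (GREATEST i. share i u v)"
  have bound: "i \<le> r" if "share i u v" for i
    using that dep_le[OF assms(1)] by (simp add: share_def)
  have m: "share m u v"
    unfolding m_def using assms(3) bound by (rule GreatestI_nat)
  have max: "i \<le> m" if "share i u v" for i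
    unfolding m_def using that bound by (rule Greatest_le_nat)
  have "m \<le> r" using m by (rule bound)
  have iff: "share i u v \<longleftrightarrow> i \<le> m" for i
    using max share_mono[OF assms(1,2) m] by blast
  have "{1..r} \<inter> {i. i \<le> m} = {1..m}"
    using \<open>m \<le> r\<close> by auto
  then have "(\<Sum>i=1..r. of_bool (share i u v) :: real) = real m"
    by (simp add: sum.If_cases of_bool_def iff)
  then show ?thesis using that m by blast
qed

text \<open>A vertex of depth at least \<open>i\<close> has exactly one ancestor on level
  \<open>i\<close>, any other vertex none.\<close>

lemma sum_of_bool_desc:
  assumes "v \<in> V"
  shows "(\<Sum>w\<in>level i. of_bool (v \<in> desc w) :: real) = of_bool (i \<le> dep v)"
proof -
  have "(\<Sum>w\<in>level i. of_bool (v \<in> desc w) :: real)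
      = (\<Sum>w\<in>level i. if w = anc i v then of_bool (i \<le> dep v) else 0)"
    using assms by (intro sum.cong) (auto simp: level_def desc_def)
  also have "\<dots> = of_bool (i \<le> dep v)"
    using assms fin anc_in[of v i] dep_anc[of v i] by (subst sum.delta) (auto simp: level_def)
  finally show ?thesis .
qed

lemma card_eq_sum_of_bool: "A \<subseteq> V \<Longrightarrow> real (card A) = (\<Sum>v\<in>V. of_bool (v \<in> A))"
  using fin by (simp add: of_bool_def sum.If_cases Int_absorb1)

lemma desc_subset: "desc w \<subseteq> V" and level_subset: "level i \<subseteq> V"
  by (auto simp: desc_def level_def)

lemma sum_card_desc:
  "(\<Sum>w\<in>level i. real (card (desc w))) = (\<Sum>v\<in>V. of_bool (i \<le> dep v))"
proof -
  have "(\<Sum>w\<in>level i. real (card (desc w))) = (\<Sum>v\<in>V. \<Sum>w\<in>level i. of_bool (v \<in> desc w))"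
    unfolding card_eq_sum_of_bool[OF desc_subset] by (rule sum.swap)
  then show ?thesis by (simp add: sum_of_bool_desc)
qed

text \<open>The pairs are sorted by their common ancestor on level \<open>i\<close>.\<close>

lemma shared_eq: "shared i = (\<Sum>w\<in>level i. real (card (desc w)) ^ 2)"
proof -
  have *: "of_bool (share i u v) = (\<Sum>w\<in>level i. of_bool (u \<in> desc w) * of_bool (v \<in> desc w) :: real)"
    if "u \<in> V" "v \<in> V" for u v
  proof -
    have "(\<Sum>w\<in>level i. of_bool (u \<in> desc w) * of_bool (v \<in> desc w) :: real)
      = (\<Sum>w\<in>level i. of_bool (u \<in> desc w) * of_bool (share i u v))"
      using that by (intro sum.cong) (auto simp: level_def desc_def share_def)
    also have "\<dots> = of_bool (share i u v)"
      using that by (simp add: sum_of_bool_desc flip: sum_distrib_right) (simp add: share_def)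
    finally show ?thesis by simp
  qed
  have "shared i = (\<Sum>u\<in>V. \<Sum>v\<in>V. \<Sum>w\<in>level i. of_bool (u \<in> desc w) * of_bool (v \<in> desc w))"
    unfolding shared_def by (intro sum.cong refl *)
  also have "\<dots> = (\<Sum>w\<in>level i. \<Sum>u\<in>V. \<Sum>v\<in>V. of_bool (u \<in> desc w) * of_bool (v \<in> desc w))"
    by (simp add: sum.swap[of _ "level i"])
  also have "\<dots> = (\<Sum>w\<in>level i. real (card (desc w)) ^ 2)"
    by (simp add: card_eq_sum_of_bool[OF desc_subset] power2_eq_square sum_product)
  finally show ?thesis .
qed

lemma sum_tdist:
  "(\<Sum>u\<in>V. \<Sum>v\<in>V. tdist u v) = 2 * real (card V) * (\<Sum>v\<in>V. real (dep v))
     + real e * (real (card V) ^ 2 - shared 0) - 2 * (\<Sum>i=1..r. shared i)"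
proof -
  have "(\<Sum>u\<in>V. \<Sum>v\<in>V. \<Sum>i=1..r. of_bool (share i u v) :: real) = (\<Sum>i=1..r. shared i)"
  proof -
    have "(\<Sum>i=1..r. shared i) = (\<Sum>u\<in>V. \<Sum>i=1..r. \<Sum>v\<in>V. of_bool (share i u v))"
      unfolding shared_def by (rule sum.swap)
    also have "\<dots> = (\<Sum>u\<in>V. \<Sum>v\<in>V. \<Sum>i=1..r. of_bool (share i u v))"
      by (intro sum.cong[OF refl] sum.swap)
    finally show ?thesis by simp
  qed
  then show ?thesis
    unfolding tdist_def by (simp add: sum.distrib sum_subtractf shared_def algebra_simps power2_eq_square
        flip: sum_distrib_left)
qed

text \<open>Depths are measured by their deficit against \<open>r\<close>, to which the bottom level
  contributes nothing.\<close>

lemma sum_dep: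
  "(\<Sum>v\<in>V. real (dep v)) = real r * real (card V) - (\<Sum>j<r. real (card (level j)) * (real r - real j))"
proof -
  have "(\<Sum>j<r. real (card (level j)) * (real r - real j))
      = (\<Sum>j<r. \<Sum>v\<in>V. if j = dep v then real r - real (dep v) else 0)"
    unfolding card_eq_sum_of_bool[OF level_subset] sum_distrib_right
    by (intro sum.cong) (auto simp: level_def)
  also have "\<dots> = (\<Sum>v\<in>V. \<Sum>j<r. if j = dep v then real r - real (dep v) else 0)"
    by (rule sum.swap)
  also have "\<dots> = (\<Sum>v\<in>V. real r - real (dep v))"
    using dep_le by (intro sum.cong) (auto simp: sum.delta dest: le_neq_implies_less)
  finally show ?thesis by (simp add: sum_subtractf)
qed

lemma finite_level [simp]: "finite (level i)"
  using fin level_subset finite_subset by blast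

end

section \<open>Comparison of \<open>tdist\<close> with the graph distance\<close>

text \<open>The route climbs to the lowest common ancestor and descends again, or passes through
  both roots if there is no common ancestor.\<close>

lemma (in connected_graph) gdist_le_tdist:
  assumes lay: "layered (pverts G) dep par r"
    and par: "\<And>v. \<lbrakk>v \<in> pverts G; 0 < dep v\<rbrakk> \<Longrightarrow> (v, par v) \<in> parcs G"
    and roots: "\<And>y z. \<lbrakk>y \<in> pverts G; z \<in> pverts G; dep y = 0; dep z = 0\<rbrakk> \<Longrightarrow> gdist G y z \<le> e"
    and uv: "u \<in> pverts G" "v \<in> pverts G"
  shows "real (gdist G u v) \<le> layered.tdist dep par r e u v"
proof -
  interpret layered "pverts G" dep par r e by (rule lay)
  have up: "gdist G x (anc i x) \<le> dep x - i" if x: "x \<in> pverts G" for x i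
  proof -
    have "(x, (par ^^ k) x) \<in> parcs G ^^ k" if "k \<le> dep x" for k
      using that
    proof (induction k)
      case (Suc k)
      then show ?case using funpow_par[OF x, of k] par[of "(par ^^ k) x"] by auto
    qed simp
    then show ?thesis unfolding anc_def using x by (intro gdist_le) auto
  qed
  show ?thesis
  proof (cases "share 0 u v")
    case True
    then obtain m where m: "share m u v" "(\<Sum>i=1..r. of_bool (share i u v) :: real) = real m"
      using share_level_eq uv by blast
    have m': "m \<le> dep u" "m \<le> dep v" "anc m u = anc m v" using m by (auto simp: share_def)
    have "gdist G u v \<le> gdist G u (anc m u) + gdist G (anc m v) v"
      using gdist_triangle[of u "anc m u" v] uv anc_in m' by simp
    also have "\<dots> \<le> (dep u - m) + (dep v - m)"
      using up[of u m] up[of v m] gdist_sym[of v "anc m v"] anc_in m' uv by simp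
    finally have "real (gdist G u v) \<le> real (dep u) - real m + (real (dep v) - real m)"
      using m' by linarith
    then show ?thesis unfolding tdist_def m(2) using True by simp
  next
    case False
    then have "\<not> share i u v" for i using share_mono[OF uv] by blast
    then have "tdist u v = real (dep u + dep v + e)" by (simp add: tdist_def)
    moreover have "gdist G u v \<le> gdist G u (anc 0 u) + (gdist G (anc 0 u) (anc 0 v) + gdist G (anc 0 v) v)"
      using gdist_triangle[of u "anc 0 u" v] gdist_triangle[of "anc 0 u" "anc 0 v" v]
        uv anc_in[of u 0] anc_in[of v 0] by simp
    moreover have "gdist G u (anc 0 u) \<le> dep u" "gdist G (anc 0 v) v \<le> dep v"
      "gdist G (anc 0 u) (anc 0 v) \<le> e"
      using up[of u 0] up[of v 0] gdist_sym[of v "anc 0 v"] anc_in[of _ 0] uv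
        roots[of "anc 0 u" "anc 0 v"] dep_anc[of _ 0] by auto
    ultimately show ?thesis by simp
  qed
qed

text \<open>As a function of its first argument \<open>tdist\<close> changes by at most 1 along an
  arc and vanishes at \<open>v\<close>, so it bounds the length of every walk to \<open>v\<close>
  from below. The bound on \<open>e\<close> covers an arc between two roots.\<close>

lemma (in connected_graph) tdist_le_gdist:
  assumes lay: "layered (pverts G) dep par r"
    and arcs: "\<And>u v. (u, v) \<in> parcs G \<Longrightarrow>
      0 < dep u \<and> v = par u \<or> 0 < dep v \<and> u = par v \<or> dep u = 0 \<and> dep v = 0"
    and e: "e \<le> 1"
    and uv: "u \<in> pverts G" "v \<in> pverts G"
  shows "layered.tdist dep par r e u v \<le> real (gdist G u v)"
proof -
  interpret layered "pverts G" dep par r e by (rule lay)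
  have step: "tdist x v \<le> tdist y v + 1" if xy: "(x, y) \<in> parcs G" for x y
  proof -
    have V: "x \<in> pverts G" "y \<in> pverts G" using arcD xy by auto
    consider (up) "0 < dep x" "y = par x" | (down) "0 < dep y" "x = par y"
      | (root) "dep x = 0" "dep y = 0"
      using arcs[OF xy] by auto
    then show ?thesis
    proof cases
      case up
      have d: "dep x = Suc (dep y)" using dep_par[of x] V up by simp
      have imp: "share i x v" if "share i y v" for i
        using that d up anc_par[of x i] V by (auto simp: share_def)
      have "(\<Sum>i=1..r. of_bool (share i y v) :: real) \<le> (\<Sum>i=1..r. of_bool (share i x v))"
        using imp by (intro sum_mono) auto
      moreover have "real e * of_bool (share 0 y v) \<le> real e * of_bool (share 0 x v)"
        using imp by (intro mult_left_mono) auto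
      ultimately show ?thesis using d by (simp add: tdist_def algebra_simps)
    next
      case down
      have d: "dep y = Suc (dep x)" using dep_par[of y] V down by simp
      \<comment> \<open>The level of \<open>y\<close> itself is the only one that \<open>y\<close>
        but not its parent \<open>x\<close> can share with \<open>v\<close>.\<close>
      have imp: "share i x v" if "share i y v" "i \<noteq> dep y" for i
        using that d down anc_par[of y i] V by (auto simp: share_def)
      have "(\<Sum>i=1..r. of_bool (share i y v) :: real)
          \<le> (\<Sum>i=1..r. of_bool (share i x v) + (if i = dep y then 1 else 0))"
        using imp by (intro sum_mono) auto
      also have "\<dots> \<le> (\<Sum>i=1..r. of_bool (share i x v)) + 1"
        by (simp add: sum.distrib)
      finally have "(\<Sum>i=1..r. of_bool (share i y v) :: real)
          \<le> (\<Sum>i=1..r. of_bool (share i x v)) + 1" .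
      moreover have "real e * of_bool (share 0 y v) \<le> real e * of_bool (share 0 x v)"
        using imp[of 0] down by (intro mult_left_mono) auto
      ultimately show ?thesis using d by (simp add: tdist_def algebra_simps)
    next
      case root
      have "(\<Sum>i=1..r. of_bool (share i x v) :: real) = 0" "(\<Sum>i=1..r. of_bool (share i y v) :: real) = 0"
        using root by (auto simp: share_def)
      moreover have "real e * (1 - of_bool (share 0 x v)) \<le> real e * (1 - of_bool (share 0 y v)) + 1"
        using e by auto
      ultimately show ?thesis using root by (simp add: tdist_def)
    qed
  qed
  have "tdist v v = 2 * real (dep v) - 2 * (\<Sum>i=1..r. of_bool (i \<le> dep v))"
    by (simp add: tdist_def share_def)
  also have "(\<Sum>i=1..r. of_bool (i \<le> dep v) :: real) = (\<Sum>i=1..dep v. 1)"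
    using dep_le[OF uv(2)] by (intro sum.mono_neutral_cong_right) auto
  finally have self: "tdist v v = 0" by simp
  have "(u, v) \<in> parcs G ^^ k \<Longrightarrow> tdist u v \<le> real k" for k
  proof (induction k arbitrary: u)
    case (Suc k)
    then obtain w where "(u, w) \<in> parcs G" "(w, v) \<in> parcs G ^^ k"
      by (meson relpow_Suc_D2)
    then show ?case using Suc.IH[of w] step[of u w] by simp
  qed (use self in simp)
  then show ?thesis using gdist_relpow[OF uv] by blast
qed

lemma double_wiener_index:
  fixes G :: "'a::linorder pair_pre_digraph"
  assumes "connected_graph G"
  shows "2 * wiener_index G = (\<Sum>u\<in>pverts G. \<Sum>v\<in>pverts G. gdist G u v)"
proof -
  interpret connected_graph G by fact
  let ?V = "pverts G"
  let ?lt = "\<lambda>u v. if u < v then gdist G u v else 0"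
  have W: "wiener_index G = (\<Sum>u\<in>?V. \<Sum>v\<in>?V. ?lt u v)"
    unfolding wiener_index_def using finite_verts
    by (intro sum.cong[OF refl] sum.inter_filter)
  have "(\<Sum>u\<in>?V. \<Sum>v\<in>?V. gdist G u v) = (\<Sum>u\<in>?V. \<Sum>v\<in>?V. ?lt u v + ?lt v u)"
    using gdist_sym by (intro sum.cong refl) auto
  also have "\<dots> = wiener_index G + (\<Sum>u\<in>?V. \<Sum>v\<in>?V. ?lt v u)"
    by (simp add: sum.distrib W)
  also have "(\<Sum>u\<in>?V. \<Sum>v\<in>?V. ?lt v u) = wiener_index G"
    unfolding W by (rule sum.swap)
  finally show ?thesis by simp
qed

section \<open>The upper bound\<close>

context layered
begin

text \<open>Convexity in the form \<open>s\<^sup>2 \<ge> 2ts - t\<^sup>2\<close>, which keeps the bound linear in the numbers of vertices.\<close>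
lemma shared_ge:
  "2 * t * (\<Sum>v\<in>V. of_bool (i \<le> dep v)) - t ^ 2 * real (card (level i)) \<le> shared i"
proof -
  have "(\<Sum>w\<in>level i. 2 * t * real (card (desc w)) - t ^ 2) \<le> shared i"
    unfolding shared_eq
  proof (rule sum_mono)
    show "2 * t * x - t ^ 2 \<le> x ^ 2" for x :: real
      using zero_le_power2[of "x - t"] by (simp add: power2_diff algebra_simps)
  qed
  then show ?thesis
    by (simp add: sum_subtractf sum_card_desc mult.commute flip: sum_distrib_left)
qed

lemma card_deep:
  "(\<Sum>v\<in>V. of_bool (i \<le> dep v)) = real (card V) - (\<Sum>j<i. real (card (level j)))"
proof -
  have "(\<Sum>j<i. real (card (level j))) = (\<Sum>v\<in>V. \<Sum>j<i. of_bool (j = dep v))"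
    unfolding card_eq_sum_of_bool[OF level_subset] by (subst sum.swap) (auto simp: level_def intro!: sum.cong)
  also have "\<dots> = (\<Sum>v\<in>V. 1 - of_bool (i \<le> dep v))"
    by (intro sum.cong refl) (auto simp: of_bool_def)
  finally show ?thesis by (simp add: sum_subtractf)
qed

text \<open>At most half of the ordered pairs can lie under different roots. The extra
  \<open>e\<close> thus adds at most \<open>e * n ^ 2 / 2\<close> to the sum over ordered pairs,
  whence the \<open>e / 4\<close> in the leading coefficient.\<close>

lemma shared_0_ge:
  assumes "card (level 0) \<le> 2"
  shows "real (card V) ^ 2 / 2 \<le> shared 0"
proof -
  let ?n = "real (card V)"
  have "?n ^ 2 / 2 \<le> 2 * (?n / 2) * ?n - (?n / 2) ^ 2 * 2"
    by (simp add: power2_eq_square)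
  also have "\<dots> \<le> 2 * (?n / 2) * ?n - (?n / 2) ^ 2 * real (card (level 0))"
    using assms by (intro diff_left_mono mult_left_mono) auto
  also have "\<dots> \<le> shared 0"
    using shared_ge[of "?n / 2" 0] by simp
  finally show ?thesis .
qed

text \<open>
  The slope \<open>t i\<close> at level \<open>i\<close> is taken slightly below the optimal \<open>\<surd>(n (r - i))\<close> in order to
  absorb the vertices above that level.
\<close>
lemma sum_tdist_le:
  assumes r: "1 \<le> r" and e: "e \<le> 1" and roots: "card (level 0) \<le> 1 + e"
    and n: "4 * r ^ 4 \<le> card V"
  shows "(\<Sum>u\<in>V. \<Sum>v\<in>V. tdist u v) \<le> 2 * ((real r + real e / 4) * real (card V) ^ 2
    - 2 * real (card V) * sqrt (card V) * (\<Sum>i=1..<r. sqrt (real r - real i)) + 4 * real r ^ 3 * real (card V))"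
proof -
  define n where "n = real (card V)"
  define k where "k j = real (card (level j))" for j
  \<comment> \<open>The shift by \<open>2 * r ^ 2\<close> changes the final bound by O(n) for fixed
    \<open>r\<close>, but lowers the square of the slope by at least
    \<open>2 * r ^ 2 * sqrt n\<close> on the inner levels, as the shift is at most
    \<open>sqrt n\<close>.\<close>
  define t where "t i = sqrt (n * (real r - real i)) - 2 * real r ^ 2" for i
  have n0: "0 \<le> n" by (simp add: n_def)
  have k0: "0 \<le> k j" for j by (simp add: k_def)
  have "real (4 * r ^ 4) \<le> n" using assms(4) unfolding n_def by (simp only: of_nat_le_iff)
  then have "(2 * real r ^ 2) ^ 2 \<le> n" by (simp add: power_mult_distrib flip: power_mult)
  then have sqn: "2 * real r ^ 2 \<le> sqrt n" by (rule real_le_rsqrt)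
  have sqr: "sqrt r \<le> real r" "1 \<le> sqrt r"
    using r by (auto simp: real_sqrt_le_iff intro!: real_le_lsqrt self_le_power simp flip: power2_eq_square)

  have t_le: "t i \<le> sqrt n * sqrt r" for i
  proof -
    have "sqrt (n * (real r - real i)) \<le> sqrt (n * real r)"
      using n0 by (intro real_sqrt_le_mono mult_left_mono) auto
    then show ?thesis
      using zero_le_power2[of "real r"] unfolding t_def real_sqrt_mult by linarith
  qed

  \<comment> \<open>A vertex at depth \<open>j\<close> is missing from the count of deep vertices on
    fewer than \<open>r\<close> lower levels, at a cost of at most \<open>2 * sqrt (n * r)\<close>
    each. Its depth deficit covers this even after paying \<open>t j ^ 2\<close>. The sums over
    slopes start at level 1, so roots have no square to pay.\<close>
  have slack: "2 * real r * (sqrt n * sqrt r) \<le> n * (real r - real j) - (if j = 0 then 0 else t j ^ 2)"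
    if j: "j < r" for j
  proof (cases "j = 0")
    case True
    have "real r \<le> real r ^ 2" using r by (intro self_le_power) auto
    then have "2 * sqrt r \<le> sqrt n" using sqr(1) sqn by linarith
    then have "(real r * sqrt n) * (2 * sqrt r) \<le> (real r * sqrt n) * sqrt n"
      using n0 by (intro mult_left_mono) auto
    also have "\<dots> = real r * n" using n0 by simp
    finally show ?thesis using True by (simp add: algebra_simps)
  next
    case False
    define q where "q = sqrt (n * (real r - real j))"
    have q2: "q ^ 2 = n * (real r - real j)" using n0 j by (simp add: q_def)
    have "sqrt (n * 1) \<le> q"
      unfolding q_def using n0 j by (intro real_sqrt_le_mono mult_left_mono) auto
    then have q: "sqrt n \<le> q" by simp
    have "2 * real r * (sqrt n * sqrt r) \<le> 2 * real r * (sqrt n * real r)"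
      using sqr n0 by (intro mult_left_mono) auto
    also have "\<dots> = 2 * real r ^ 2 * sqrt n" by (simp add: power2_eq_square)
    also have "\<dots> \<le> 4 * real r ^ 2 * sqrt n - 4 * real r ^ 4"
    proof -
      have "2 * real r ^ 2 * (2 * real r ^ 2) \<le> 2 * real r ^ 2 * sqrt n"
        using sqn by (intro mult_left_mono) auto
      then show ?thesis by (simp add: algebra_simps flip: power_add)
    qed
    also have "\<dots> \<le> 4 * real r ^ 2 * q - 4 * real r ^ 4"
      using q by (intro diff_right_mono mult_left_mono) auto
    also have "\<dots> = n * (real r - real j) - t j ^ 2"
      unfolding t_def q_def[symmetric] by (simp add: power2_diff q2 power_mult_distrib flip: power_mult)
    finally show ?thesis using False by simp
  qed

  have inner: "2 * t i * (\<Sum>j<i. k j) \<le> 2 * (sqrt n * sqrt r) * (\<Sum>j<r. k j)" if "i < r" for i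
  proof -
    have "2 * t i * (\<Sum>j<i. k j) \<le> 2 * (sqrt n * sqrt r) * (\<Sum>j<i. k j)"
      using t_le k0 by (intro mult_right_mono sum_nonneg) auto
    also have "\<dots> \<le> 2 * (sqrt n * sqrt r) * (\<Sum>j<r. k j)"
      using k0 n0 that by (intro mult_left_mono sum_mono2) auto
    finally show ?thesis .
  qed
  have "(\<Sum>i=1..<r. 2 * t i * (\<Sum>j<i. k j)) \<le> (\<Sum>i=1..<r. 2 * (sqrt n * sqrt r) * (\<Sum>j<r. k j))"
    using inner by (intro sum_mono) auto
  also have "\<dots> = real (r - 1) * (2 * (sqrt n * sqrt r) * (\<Sum>j<r. k j))"
    by simp
  also have "\<dots> \<le> real r * (2 * (sqrt n * sqrt r) * (\<Sum>j<r. k j))"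
    using k0 n0 by (intro mult_right_mono mult_nonneg_nonneg sum_nonneg) auto
  also have "\<dots> = (\<Sum>j<r. k j * (2 * real r * (sqrt n * sqrt r)))"
    by (simp add: sum_distrib_left mult_ac)
  also have "\<dots> \<le> (\<Sum>j<r. k j * (n * (real r - real j) - (if j = 0 then 0 else t j ^ 2)))"
    using slack k0 by (intro sum_mono mult_left_mono) auto
  also have "\<dots> = n * (\<Sum>j<r. k j * (real r - real j)) - (\<Sum>j<r. if j = 0 then 0 else t j ^ 2 * k j)"
    unfolding sum_distrib_left sum_subtractf[symmetric]
    by (intro sum.cong) (auto simp: algebra_simps)
  also have "(\<Sum>j<r. if j = 0 then 0 else t j ^ 2 * k j) = (\<Sum>j=1..<r. t j ^ 2 * k j)"
    by (intro sum.mono_neutral_cong_right) auto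
  finally have absorb: "(\<Sum>i=1..<r. 2 * t i * (\<Sum>j<i. k j)) + (\<Sum>i=1..<r. t i ^ 2 * k i)
    \<le> n * (\<Sum>j<r. k j * (real r - real j))" by simp

  have "(\<Sum>i=1..<r. 2 * t i * (n - (\<Sum>j<i. k j)) - t i ^ 2 * k i) \<le> (\<Sum>i=1..<r. shared i)"
    using shared_ge unfolding card_deep k_def n_def by (intro sum_mono) auto
  also have "\<dots> \<le> (\<Sum>i=1..r. shared i)"
    by (intro sum_mono2) (auto simp: shared_def sum_nonneg)
  finally have "2 * n * (\<Sum>i=1..<r. t i) - (\<Sum>i=1..<r. 2 * t i * (\<Sum>j<i. k j))
      - (\<Sum>i=1..<r. t i ^ 2 * k i) \<le> (\<Sum>i=1..r. shared i)"
    by (simp add: right_diff_distrib sum_subtractf sum_distrib_left mult_ac)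
  with absorb have main: "2 * n * (\<Sum>i=1..<r. t i)
      \<le> n * (\<Sum>j<r. k j * (real r - real j)) + (\<Sum>i=1..r. shared i)" by linarith

  have "n * (\<Sum>i=1..<r. t i) = n * sqrt n * (\<Sum>i=1..<r. sqrt (real r - real i)) - n * (real (r - 1) * (2 * real r ^ 2))"
    unfolding t_def real_sqrt_mult
    by (simp add: sum_subtractf algebra_simps flip: sum_distrib_left)
  moreover have "n * (real (r - 1) * (2 * real r ^ 2)) \<le> n * (real r * (2 * real r ^ 2))"
    using n0 by (intro mult_left_mono mult_right_mono) auto
  ultimately have ts: "n * sqrt n * (\<Sum>i=1..<r. sqrt (real r - real i)) - 2 * real r ^ 3 * n \<le> n * (\<Sum>i=1..<r. t i)"
    by (simp add: power2_eq_square power3_eq_cube mult_ac)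

  have root_term: "real e * (n ^ 2 - shared 0) \<le> real e * (n ^ 2 / 2)"
    using shared_0_ge roots e by (intro mult_left_mono) (auto simp: n_def field_simps)
  have "(\<Sum>u\<in>V. \<Sum>v\<in>V. tdist u v) = 2 * n * (real r * n - (\<Sum>j<r. k j * (real r - real j)))
      + real e * (n ^ 2 - shared 0) - 2 * (\<Sum>i=1..r. shared i)"
    unfolding sum_tdist sum_dep n_def k_def by simp
  also have "\<dots> \<le> 2 * real r * n ^ 2 + real e * (n ^ 2 / 2) - 4 * (n * (\<Sum>i=1..<r. t i))"
    using root_term main by (simp add: algebra_simps power2_eq_square)
  also have "\<dots> \<le> 2 * ((real r + real e / 4) * n ^ 2
    - 2 * n * sqrt n * (\<Sum>i=1..<r. sqrt (real r - real i)) + 4 * real r ^ 3 * n)"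
    using ts by (simp add: algebra_simps)
  finally show ?thesis unfolding n_def .
qed

end

text \<open>Depth is the distance to \<open>Z\<close>, and a parent is the next vertex on a geodesic
  to a nearest root. Its depth is smaller by exactly 1 because the distance to \<open>Z\<close>
  changes by at most 1 along an arc.\<close>

lemma (in connected_graph) layered_of_roots:
  assumes Z: "Z \<subseteq> pverts G" "Z \<noteq> {}"
    and near: "\<And>v. v \<in> pverts G \<Longrightarrow> \<exists>z\<in>Z. gdist G v z \<le> r"
  obtains dep par where "layered (pverts G) dep par r"
    "\<And>v. \<lbrakk>v \<in> pverts G; 0 < dep v\<rbrakk> \<Longrightarrow> (v, par v) \<in> parcs G"
    "\<And>v. v \<in> pverts G \<Longrightarrow> dep v = 0 \<longleftrightarrow> v \<in> Z"
proof -
  define dep where "dep v = (LEAST k. \<exists>z\<in>Z. gdist G v z = k)" for v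
  have dep_ex: "\<exists>z\<in>Z. gdist G v z = dep v" for v
    unfolding dep_def by (rule LeastI_ex) (use Z(2) in blast)
  have dep_le: "dep v \<le> gdist G v z" if "z \<in> Z" for v z
    unfolding dep_def by (rule Least_le) (use that in blast)
  have ex: "\<exists>w. (v, w) \<in> parcs G \<and> Suc (dep w) = dep v" if v: "v \<in> pverts G" "0 < dep v" for v
  proof -
    obtain z where z: "z \<in> Z" "gdist G v z = dep v" using dep_ex by blast
    have zV: "z \<in> pverts G" using z Z by blast
    obtain k where k: "dep v = Suc k" using v(2) gr0_implies_Suc by blast
    have "gdist G z v = Suc k" using gdist_sym[OF v(1) zV] z k by simp
    then obtain w where w: "(w, v) \<in> parcs G" "gdist G z w = k"
      using gdist_pred zV v(1) by blast
    have wV: "w \<in> pverts G" using arcD w by blast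
    have le: "dep w \<le> k" using dep_le[OF z(1), of w] gdist_sym[OF wV zV] w by simp
    obtain z' where z': "z' \<in> Z" "gdist G w z' = dep w" using dep_ex by blast
    have zV': "z' \<in> pverts G" using z' Z by blast
    have "dep v \<le> gdist G z' v" using dep_le[OF z'(1), of v] gdist_sym[OF v(1) zV'] by simp
    also have "\<dots> \<le> Suc (dep w)" using gdist_arc_le[OF zV' w(1)] gdist_sym[OF wV zV'] z' by simp
    finally have "Suc (dep w) = dep v" using le k by simp
    then show ?thesis using arcD(3)[OF w(1)] by blast
  qed
  define par where "par v = (SOME w. (v, w) \<in> parcs G \<and> Suc (dep w) = dep v)" for v
  have par: "(v, par v) \<in> parcs G" "Suc (dep (par v)) = dep v" if "v \<in> pverts G" "0 < dep v" for v
    using someI_ex[OF ex[OF that]] by (auto simp: par_def)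
  have lay: "layered (pverts G) dep par r"
  proof
    show "par v \<in> pverts G" if "v \<in> pverts G" "0 < dep v" for v
      using par(1)[OF that] by (rule arcD)
    show "dep v \<le> r" if "v \<in> pverts G" for v
      using near[OF that] dep_le by (meson order_trans)
  qed (use finite_verts par in auto)
  have "dep v = 0 \<longleftrightarrow> v \<in> Z" if v: "v \<in> pverts G" for v
  proof
    assume "dep v = 0"
    then obtain z where "z \<in> Z" "gdist G v z = 0" using dep_ex[of v] by auto
    then show "v \<in> Z" using gdist_eq_0_iff v Z by auto
  next
    assume "v \<in> Z"
    then show "dep v = 0" using dep_le[of v v] v by simp
  qed
  then show ?thesis using that[OF lay] par by blast
qed

lemma wiener_index_le:
  fixes G :: "'a::linorder pair_pre_digraph"
  assumes G: "is_tree G" and d: "2 \<le> gdiameter G"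
    and r: "r = gdiameter G div 2" and e: "e = gdiameter G mod 2"
    and n: "n = card (pverts G)" "4 * r ^ 4 \<le> n"
  shows "real (wiener_index G) \<le> (real r + real e / 4) * real n ^ 2
    - 2 * real n * sqrt n * (\<Sum>i=1..<r. sqrt (real r - real i)) + 4 * real r ^ 3 * real n"
proof -
  interpret tree_graph G using G by (simp add: is_tree_iff)
  obtain Z where Z: "Z \<subseteq> pverts G" "Z \<noteq> {}" "card Z \<le> 1 + e"
    "\<And>y z. \<lbrakk>y \<in> Z; z \<in> Z\<rbrakk> \<Longrightarrow> gdist G y z \<le> e"
    "\<And>v. v \<in> pverts G \<Longrightarrow> \<exists>z\<in>Z. gdist G v z \<le> r"
    using center[OF d] unfolding r e by blast
  obtain dep par where lay: "layered (pverts G) dep par r"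
    and par: "\<And>v. \<lbrakk>v \<in> pverts G; 0 < dep v\<rbrakk> \<Longrightarrow> (v, par v) \<in> parcs G"
    and dep0: "\<And>v. v \<in> pverts G \<Longrightarrow> dep v = 0 \<longleftrightarrow> v \<in> Z"
    using layered_of_roots[OF Z(1,2,5)] by blast
  interpret layered "pverts G" dep par r e by (rule lay)
  have "level 0 = Z" using dep0 Z(1) by (auto simp: level_def)
  then have roots: "card (level 0) \<le> 1 + e" using Z(3) by simp
  have "real (2 * wiener_index G) = (\<Sum>u\<in>pverts G. \<Sum>v\<in>pverts G. real (gdist G u v))"
    unfolding double_wiener_index[OF connected_graph_axioms] by simp
  also have "\<dots> \<le> (\<Sum>u\<in>pverts G. \<Sum>v\<in>pverts G. tdist u v)"
    using par dep0 Z(4) by (intro sum_mono gdist_le_tdist[OF lay]) auto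
  also have "\<dots> \<le> 2 * ((real r + real e / 4) * real n ^ 2
    - 2 * real n * sqrt n * (\<Sum>i=1..<r. sqrt (real r - real i)) + 4 * real r ^ 3 * real n)"
    unfolding n(1)
  proof (rule sum_tdist_le)
    show "1 \<le> r" "e \<le> 1" "4 * r ^ 4 \<le> card (pverts G)" using d n r e by auto
  qed (rule roots)
  finally show ?thesis by simp
qed

section \<open>Graphs of rooted trees\<close>

lemma pawalk_verts_nth:
  assumes "set p \<subseteq> parcs G" "pcas u p v"
  shows "length (pawalk_verts u p) = Suc (length p) \<and> pawalk_verts u p ! 0 = u \<and>
    pawalk_verts u p ! length p = v \<and>
    (\<forall>i<length p. (pawalk_verts u p ! i, pawalk_verts u p ! Suc i) \<in> parcs G)"
  using assms
proof (induction p arbitrary: u)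
  case (Cons a p)
  then have IH: "length (pawalk_verts (snd a) p) = Suc (length p) \<and> pawalk_verts (snd a) p ! 0 = snd a \<and>
    pawalk_verts (snd a) p ! length p = v \<and>
    (\<forall>i<length p. (pawalk_verts (snd a) p ! i, pawalk_verts (snd a) p ! Suc i) \<in> parcs G)"
    by simp
  show ?case
  proof (intro conjI allI impI)
    fix i assume "i < length (a # p)"
    then show "(pawalk_verts u (a # p) ! i, pawalk_verts u (a # p) ! Suc i) \<in> parcs G"
      using IH Cons.prems by (cases i) auto
  qed (use IH Cons.prems in auto)
qed simp

text \<open>The deepest vertex of a cycle would have two neighbours that are not deeper.\<close>
lemma acyclic_if_unique_lower_neighbour:
  fixes dep :: "'a \<Rightarrow> nat"
  assumes sym: "\<And>u v. (u, v) \<in> parcs G \<Longrightarrow> (v, u) \<in> parcs G"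
    and unique: "\<And>v a b. \<lbrakk>(v, a) \<in> parcs G; (v, b) \<in> parcs G; dep a \<le> dep v; dep b \<le> dep v\<rbrakk> \<Longrightarrow> a = b"
  shows "\<not> (\<exists>p. pre_digraph.cycle (with_proj G) p \<and> 3 \<le> length p)"
proof
  assume "\<exists>p. pre_digraph.cycle (with_proj G) p \<and> 3 \<le> length p"
  then obtain p u where p: "set p \<subseteq> parcs G" "pcas u p u" "distinct (tl (pawalk_verts u p))" "3 \<le> length p"
    by (auto simp: pre_digraph.cycle_def pre_digraph.awalk_def cas_with_proj_eq awalk_verts_with_proj_eq)
  define L where "L = length p"
  define w where "w i = pawalk_verts u p ! i" for i
  have len: "length (pawalk_verts u p) = Suc L" and w0: "w 0 = w L"
    and arcs: "\<And>i. i < L \<Longrightarrow> (w i, w (Suc i)) \<in> parcs G"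
    using pawalk_verts_nth[OF p(1,2)] by (auto simp: L_def w_def)
  \<comment> \<open>Position 0 repeats position \<open>L\<close>, and only the tail of the vertex
    list is distinct; hence the positions \<open>1..L\<close>.\<close>
  have inj: "i = j" if "w i = w j" "i \<in> {1..L}" "j \<in> {1..L}" for i j
  proof -
    have "tl (pawalk_verts u p) ! (i - 1) = tl (pawalk_verts u p) ! (j - 1)"
      using that len by (cases i; cases j) (auto simp: nth_tl w_def)
    then have "i - 1 = j - 1"
      using p(3) that len by (subst (asm) nth_eq_iff_index_eq) auto
    then show ?thesis using that by auto
  qed
  have L: "3 \<le> L" using p by (simp add: L_def)
  define m where "m = Max ((\<lambda>i. dep (w i)) ` {1..L})"
  have "m \<in> (\<lambda>i. dep (w i)) ` {1..L}"
    unfolding m_def using L by (intro Max_in) auto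
  then obtain i where i: "i \<in> {1..L}" "dep (w i) = m" by auto
  have max: "dep (w j) \<le> m" if "j \<in> {1..L}" for j
    unfolding m_def using that by (intro Max_ge) auto
  \<comment> \<open>Cyclic predecessor and successor, which differ because
    \<open>3 \<le> L\<close>.\<close>
  define prv where "prv = (if i = 1 then L else i - 1)"
  define nxt where "nxt = (if i = L then 1 else Suc i)"
  have in_range: "prv \<in> {1..L}" "nxt \<in> {1..L}" and "prv \<noteq> nxt"
    using i L by (auto simp: prv_def nxt_def)
  have "(w prv, w i) \<in> parcs G" "(w i, w nxt) \<in> parcs G"
    using arcs[of "i - 1"] arcs[of i] arcs[of 0] i L w0 by (auto simp: prv_def nxt_def)
  then have "w prv = w nxt"
    using unique[of "w i" "w prv" "w nxt"] max in_range i sym by auto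
  then show False using inj in_range \<open>prv \<noteq> nxt\<close> by blast
qed

context layered
begin

text \<open>All roots are joined to each other; with at most two roots this adds no more than the
  edge between them.\<close>

definition tgraph :: "'a pair_pre_digraph" where
  "tgraph = \<lparr>pverts = V, parcs = {(u, v). u \<in> V \<and> v \<in> V \<and> u \<noteq> v \<and>
     (0 < dep u \<and> v = par u \<or> 0 < dep v \<and> u = par v \<or> dep u = 0 \<and> dep v = 0)}\<rparr>"

lemma pverts_tgraph [simp]: "pverts tgraph = V"
  by (simp add: tgraph_def)

lemma parcs_tgraph:
  "(u, v) \<in> parcs tgraph \<longleftrightarrow> u \<in> V \<and> v \<in> V \<and> u \<noteq> v \<and>
     (0 < dep u \<and> v = par u \<or> 0 < dep v \<and> u = par v \<or> dep u = 0 \<and> dep v = 0)"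
  by (simp add: tgraph_def)

lemma par_arc:
  assumes "v \<in> V" "0 < dep v" shows "(v, par v) \<in> parcs tgraph"
  using assms par_in[OF assms] dep_par[OF assms] by (auto simp: parcs_tgraph)

lemma pair_graph_tgraph: "pair_graph tgraph"
proof
  show "finite (parcs tgraph)"
    by (rule finite_subset[of _ "V \<times> V"]) (use fin in \<open>auto simp: parcs_tgraph\<close>)
  show "symmetric (with_proj tgraph)"
    by (auto simp: symmetric_def sym_def parcs_tgraph)
qed (use fin in \<open>auto simp: parcs_tgraph\<close>)

lemma connected_tgraph:
  assumes "level 0 \<noteq> {}"
  shows "Digraph_Component.connected (with_proj tgraph)"
proof -
  have sym: "(u, v) \<in> parcs tgraph \<Longrightarrow> (v, u) \<in> parcs tgraph" for u v
    by (auto simp: parcs_tgraph)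
  then have symcl: "(parcs tgraph)\<^sup>s = parcs tgraph" by (auto simp: symcl_def)
  have to_root: "\<exists>z. z \<in> V \<and> dep z = 0 \<and> (v, z) \<in> (parcs tgraph)\<^sup>*" if "v \<in> V" for v
    using that
  proof (induction "dep v" arbitrary: v)
    case (Suc k)
    then have v: "0 < dep v" by simp
    obtain z where "z \<in> V" "dep z = 0" "(par v, z) \<in> (parcs tgraph)\<^sup>*"
      using Suc.hyps(1)[of "par v"] Suc.hyps(2) par_in[OF Suc.prems v] dep_par[OF Suc.prems v] by auto
    then show ?case using par_arc[OF Suc.prems v] by (meson converse_rtrancl_into_rtrancl)
  qed auto
  have "(u, v) \<in> (parcs tgraph)\<^sup>*" if uv: "u \<in> V" "v \<in> V" for u v
  proof -
    obtain y where y: "y \<in> V" "dep y = 0" "(u, y) \<in> (parcs tgraph)\<^sup>*" using to_root uv by blast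
    obtain z where z: "z \<in> V" "dep z = 0" "(v, z) \<in> (parcs tgraph)\<^sup>*" using to_root uv by blast
    have "(y, z) \<in> (parcs tgraph)\<^sup>*" using y z by (cases "y = z") (auto simp: parcs_tgraph)
    moreover have "(z, v) \<in> (parcs tgraph)\<^sup>*"
      using z(3) sym by (metis sym_rtrancl symD symI)
    ultimately show ?thesis using y(3) by (meson rtrancl_trans)
  qed
  moreover have "V \<noteq> {}" using assms by (auto simp: level_def)
  ultimately show ?thesis
    by (auto simp: connected_conv symcl parcs_tgraph intro!: rtrancl_consistent_rtrancl_on)
qed

text \<open>It is the parent at positive depth, and the other root at depth 0.\<close>

lemma unique_lower_neighbour:
  assumes "card (level 0) \<le> 2"
    and "(v, a) \<in> parcs tgraph" "(v, b) \<in> parcs tgraph" "dep a \<le> dep v" "dep b \<le> dep v"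
  shows "a = b"
proof -
  have nb: "0 < dep v \<and> x = par v \<or> dep v = 0 \<and> x \<in> level 0 - {v} \<and> v \<in> level 0"
    if "(v, x) \<in> parcs tgraph" "dep x \<le> dep v" for x
    using that dep_par[of x] by (auto simp: parcs_tgraph level_def)
  show ?thesis
  proof (cases "dep v = 0")
    case False
    then show ?thesis using nb assms by metis
  next
    case True
    then have in0: "a \<in> level 0 - {v}" "b \<in> level 0 - {v}" "v \<in> level 0"
      using nb assms by auto
    have fin0: "finite (level 0 - {v})" by simp
    have "card (level 0 - {v}) \<le> Suc 0" using assms(1) in0(3) by simp
    then show ?thesis using in0 unfolding card_le_Suc0_iff_eq[OF fin0] by blast
  qed
qed

lemma is_tree_tgraph:
  assumes "level 0 \<noteq> {}" "card (level 0) \<le> 2"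
  shows "is_tree tgraph"
  unfolding is_tree_def
proof (intro conjI pair_graph_tgraph connected_tgraph assms(1))
  show "\<not> (\<exists>p. pre_digraph.cycle (with_proj tgraph) p \<and> 3 \<le> length p)"
  proof (rule acyclic_if_unique_lower_neighbour)
    show "(u, v) \<in> parcs tgraph \<Longrightarrow> (v, u) \<in> parcs tgraph" for u v
      by (auto simp: parcs_tgraph)
  qed (rule unique_lower_neighbour[OF assms(2)])
qed

lemma
  assumes "card (level 0) = 1 + e" "e \<le> 1"
  shows is_tree_tgraph_roots: "is_tree tgraph"
    and gdist_tgraph: "\<And>u v. \<lbrakk>u \<in> V; v \<in> V\<rbrakk> \<Longrightarrow> real (gdist tgraph u v) = tdist u v"
proof -
  have "level 0 \<noteq> {}" using assms by auto
  then show tree: "is_tree tgraph" using assms by (intro is_tree_tgraph) auto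
  interpret T: tree_graph tgraph using tree by (simp add: is_tree_iff)
  have lay: "layered (pverts tgraph) dep par r" using layered_axioms by simp
  have roots: "gdist tgraph y z \<le> e" if "y \<in> V" "z \<in> V" "dep y = 0" "dep z = 0" for y z
  proof (cases "y = z")
    case False
    have "{y, z} \<subseteq> level 0" using that by (auto simp: level_def)
    then have "card {y, z} \<le> 1 + e"
      unfolding assms(1)[symmetric] by (intro card_mono) simp
    then have "1 \<le> e" using False by simp
    moreover have "(y, z) \<in> parcs tgraph" using that False by (simp add: parcs_tgraph)
    then have "gdist tgraph y z \<le> 1" using T.gdist_arc_le[of y y z] that by simp
    ultimately show ?thesis by simp
  qed (use that in simp)
  show "real (gdist tgraph u v) = tdist u v" if "u \<in> V" "v \<in> V" for u v
  proof (rule antisym)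
    show "real (gdist tgraph u v) \<le> tdist u v"
      using that roots by (intro T.gdist_le_tdist[OF lay] par_arc) auto
    show "tdist u v \<le> real (gdist tgraph u v)"
      using that assms(2) by (intro T.tdist_le_gdist[OF lay]) (auto simp: parcs_tgraph)
  qed
qed

text \<open>Two bottom vertices in different branches attain the largest possible
  \<open>tdist\<close>. For \<open>e = 0\<close> they may meet in the root, so they are separated
  only from level 1 on.\<close>

lemma gdiameter_tgraph:
  assumes "card (level 0) = 1 + e" "e \<le> 1"
    and uv: "u \<in> V" "v \<in> V" "dep u = r" "dep v = r"
    and apart: "\<not> share 1 u v" "0 < e \<Longrightarrow> \<not> share 0 u v"
  shows "gdiameter tgraph = 2 * r + e"
proof -
  interpret T: tree_graph tgraph using is_tree_tgraph_roots[OF assms(1,2)] by (simp add: is_tree_iff)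
  have "\<not> share i u v" if "1 \<le> i" for i
    using share_mono[OF uv(1,2), of i 1] that apart(1) by blast
  then have "(\<Sum>i=1..r. of_bool (share i u v) :: real) = 0" by simp
  moreover have "real e * of_bool (share 0 u v) = 0" using apart(2) by (cases "e = 0") auto
  ultimately have "tdist u v = real (2 * r + e)"
    unfolding tdist_def using uv by (simp add: right_diff_distrib)
  then have "gdist tgraph u v = 2 * r + e"
    using gdist_tgraph[OF assms(1,2) uv(1,2)] by linarith
  moreover have "gdist tgraph x y \<le> 2 * r + e" if xy: "x \<in> V" "y \<in> V" for x y
  proof -
    have "real e * (1 - of_bool (share 0 x y)) \<le> real e" by simp
    moreover have "0 \<le> (\<Sum>i=1..r. of_bool (share i x y) :: real)" by (intro sum_nonneg) auto
    ultimately have "tdist x y \<le> real (dep x + dep y + e)" unfolding tdist_def by simp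
    then show ?thesis using gdist_tgraph[OF assms(1,2) xy] dep_le[OF xy(1)] dep_le[OF xy(2)] by linarith
  qed
  moreover obtain x y where "x \<in> V" "y \<in> V" "gdist tgraph x y = gdiameter tgraph"
    using T.diametral_pair by auto
  ultimately show ?thesis
    using T.gdist_le_diameter[of u v] uv by (metis antisym pverts_tgraph)
qed

end

section \<open>Trees with evenly distributed descendants\<close>

text \<open>A residue class takes its exact share when \<open>q\<close> divides \<open>M\<close>,
  and at most one element more otherwise.\<close>

lemma card_mod_eq_le:
  fixes M q a :: nat
  assumes "0 < q"
  shows "real (card {j. j < M \<and> j mod q = a}) \<le> real M / real q + of_bool (\<not> q dvd M)"
proof -
  let ?A = "{j. j < M \<and> j mod q = a}"
  have inj: "inj_on (\<lambda>j. j div q) ?A"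
    by (intro inj_onI) (metis (mono_tags, lifting) div_mult_mod_eq mem_Collect_eq)
  show ?thesis
  proof (cases "q dvd M")
    case True
    then obtain c where c: "M = q * c" by blast
    have "card ?A \<le> card {..<c}"
      using c by (intro card_inj_on_le[OF inj]) (auto simp: less_mult_imp_div_less mult.commute)
    then show ?thesis using c assms by simp
  next
    case False
    have "card ?A \<le> card {..M div q}"
      by (intro card_inj_on_le[OF inj]) (auto intro: div_le_mono)
    then have "real (card ?A) \<le> real (M div q) + 1" by simp
    also have "real (M div q) \<le> real M / real q" by (rule of_nat_div_le_of_nat)
    finally show ?thesis using False by simp
  qed
qed

text \<open>
  The vertices at depth \<open>i\<close> are numbered by \<open>{..<K i}\<close>; the parent of number \<open>j\<close> at depth
  \<open>i + 1\<close> is number \<open>j mod K i\<close>, which distributes the children of each level evenly.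
\<close>
locale mod_tree =
  fixes K :: "nat \<Rightarrow> nat" and r e :: nat
  assumes r: "1 \<le> r" and e: "e \<le> 1" and K0: "K 0 = 1 + e"
    and K_dvd: "\<lbrakk>i \<le> j; j < r\<rbrakk> \<Longrightarrow> K i dvd K j"
    and K_ge: "\<lbrakk>1 \<le> i; i \<le> r\<rbrakk> \<Longrightarrow> 2 \<le> K i"
    and K_le: "\<lbrakk>1 \<le> i; i \<le> j; j < r\<rbrakk> \<Longrightarrow> K j \<le> 2 * K i"
begin

text \<open>Pairs of depth and number are encoded because \<open>max_wiener_index\<close> ranges
  over trees with vertices in \<open>nat\<close>.\<close>

definition V :: "nat set" where
  "V = prod_encode ` (SIGMA i:{..r}. {..<K i})"

definition dep :: "nat \<Rightarrow> nat" where
  "dep v = fst (prod_decode v)"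

definition idx :: "nat \<Rightarrow> nat" where
  "idx v = snd (prod_decode v)"

definition par :: "nat \<Rightarrow> nat" where
  "par v = prod_encode (dep v - 1, idx v mod K (dep v - 1))"

lemma dep_encode [simp]: "dep (prod_encode (i, j)) = i" and idx_encode [simp]: "idx (prod_encode (i, j)) = j"
  by (simp_all add: dep_def idx_def)

lemma encode_dep_idx [simp]: "prod_encode (dep v, idx v) = v"
  by (simp add: dep_def idx_def)

lemma V_iff: "v \<in> V \<longleftrightarrow> dep v \<le> r \<and> idx v < K (dep v)"
proof
  assume "dep v \<le> r \<and> idx v < K (dep v)"
  then have "prod_encode (dep v, idx v) \<in> V" unfolding V_def by (intro imageI) auto
  then show "v \<in> V" by simp
qed (auto simp: V_def)

lemma dep_par_Suc: "0 < dep v \<Longrightarrow> Suc (dep (par v)) = dep v" and idx_par: "idx (par v) = idx v mod K (dep v - 1)"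
  by (simp_all add: par_def)

lemma K_pos: "i \<le> r \<Longrightarrow> 0 < K i"
  using K0 K_ge[of i] by (cases "i = 0") auto

sublocale layered V dep par r e
proof
  show "par v \<in> V" if "v \<in> V" "0 < dep v" for v
    using that K_pos[of "dep v - 1"] by (auto simp: V_iff par_def)
qed (auto simp: V_def dep_par_Suc)

text \<open>As \<open>K l\<close> divides the later moduli, the successive reductions on the way up
  collapse to a single one. This is the purpose of \<open>K_dvd\<close>.\<close>

lemma idx_anc:
  assumes "v \<in> V" "l \<le> dep v" "l < r"
  shows "idx (anc l v) = idx v mod K l"
  using assms
proof (induction "dep v - l" arbitrary: v)
  case 0
  then have "dep v = l" by simp
  then show ?case using 0 anc_self[of v] by (auto simp: V_iff)
next
  case (Suc k)
  then have lt: "l < dep v" by simp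
  have Vd: "par v \<in> V" "Suc (dep (par v)) = dep v" using par_in dep_par Suc.prems lt by auto
  have "idx (anc l v) = idx (anc l (par v))" using anc_par Suc.prems(1) lt by simp
  also have "\<dots> = idx (par v) mod K l"
    using Suc.hyps(1)[of "par v"] Suc.hyps(2) Suc.prems lt Vd by auto
  also have "\<dots> = idx v mod K l"
    using K_dvd[of l "dep v - 1"] Suc.prems dep_le[of v] lt by (simp add: idx_par mod_mod_cancel)
  finally show ?case .
qed

lemma level_eq:
  assumes "i \<le> r"
  shows "level i = (\<lambda>j. prod_encode (i, j)) ` {..<K i}"
proof
  show "level i \<subseteq> (\<lambda>j. prod_encode (i, j)) ` {..<K i}"
  proof
    fix v assume "v \<in> level i"
    then have "dep v = i" "idx v < K i" by (auto simp: level_def V_iff)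
    then show "v \<in> (\<lambda>j. prod_encode (i, j)) ` {..<K i}"
      using encode_dep_idx[of v] by (intro image_eqI[of _ _ "idx v"]) auto
  qed
qed (use assms in \<open>auto simp: level_def V_iff\<close>)

lemma card_level: "i \<le> r \<Longrightarrow> card (level i) = K i"
  by (simp add: level_eq card_image inj_on_def)

lemma card_V: "card V = (\<Sum>i\<le>r. K i)"
  unfolding V_def by (subst card_image) (auto intro: inj_on_subset[OF inj_prod_encode])

text \<open>The descendants on each level form a residue class modulo \<open>K l\<close>. The shares
  are exact above the bottom level, whose arbitrary size accounts for the
  \<open>+ 1\<close>.\<close>

lemma card_desc_le:
  assumes "l < r" "w \<in> level l"
  shows "real (card (desc w)) \<le> (\<Sum>i=l..<r. real (K i) / real (K l)) + real (K r) / real (K l) + 1"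
proof -
  let ?B = "\<lambda>i. {j. j < K i \<and> j mod K l = idx w}"
  have "desc w \<subseteq> prod_encode ` (SIGMA i:{l..r}. ?B i)"
  proof
    fix v assume "v \<in> desc w"
    then have v: "v \<in> V" "l \<le> dep v" "anc l v = w" using assms by (auto simp: desc_def level_def)
    then have "(dep v, idx v) \<in> (SIGMA i:{l..r}. ?B i)"
      using idx_anc[of v l] assms by (auto simp: V_iff)
    then have "prod_encode (dep v, idx v) \<in> prod_encode ` (SIGMA i:{l..r}. ?B i)"
      by (rule imageI)
    then show "v \<in> prod_encode ` (SIGMA i:{l..r}. ?B i)" by simp
  qed
  then have "card (desc w) \<le> card (prod_encode ` (SIGMA i:{l..r}. ?B i))"
    by (intro card_mono) auto
  also have "\<dots> = (\<Sum>i=l..r. card (?B i))"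
    by (subst card_image) (auto intro: inj_on_subset[OF inj_prod_encode])
  finally have "real (card (desc w)) \<le> (\<Sum>i=l..r. real (card (?B i)))"
    by (simp flip: of_nat_sum)
  also have "\<dots> = (\<Sum>i=l..<r. real (card (?B i))) + real (card (?B r))"
    using assms(1) by (simp add: sum.last_plus)
  also have "\<dots> \<le> (\<Sum>i=l..<r. real (K i) / real (K l)) + (real (K r) / real (K l) + 1)"
  proof (intro add_mono sum_mono)
    show "real (card (?B i)) \<le> real (K i) / real (K l)" if "i \<in> {l..<r}" for i
      using card_mod_eq_le[of "K l" "K i" "idx w"] K_dvd[of l i] K_pos[of l] that assms(1) by simp
    show "real (card (?B r)) \<le> real (K r) / real (K l) + 1"
      by (rule order_trans[OF card_mod_eq_le]) (use K_pos[of l] assms(1) in auto)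
  qed
  finally show ?thesis by simp
qed

lemma shared_le:
  assumes "l \<le> r" and "\<And>w. w \<in> level l \<Longrightarrow> real (card (desc w)) \<le> b"
  shows "shared l \<le> real (K l) * b ^ 2"
proof -
  have "shared l \<le> (\<Sum>w\<in>level l. b ^ 2)"
    unfolding shared_eq using assms(2) by (intro sum_mono power_mono) auto
  then show ?thesis by (simp add: card_level[OF assms(1)])
qed

lemma shared_r_le: "shared r \<le> real (card V)"
proof -
  have "real (card (desc w)) \<le> 1" if "w \<in> level r" for w
  proof -
    have "desc w \<subseteq> {w}"
    proof
      fix v assume v: "v \<in> desc w"
      then have "dep v = dep w" using that dep_le[of v] by (simp add: desc_def level_def)
      then show "v \<in> {w}" using v anc_self[of v] by (simp add: desc_def)
    qed
    then have "card (desc w) \<le> card {w}" by (intro card_mono) auto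
    then show ?thesis by simp
  qed
  then have "shared r \<le> real (K r)" using shared_le[of r 1] by simp
  also have "\<dots> \<le> real (card V)" unfolding card_V by (intro of_nat_mono member_le_sum) auto
  finally show ?thesis .
qed

text \<open>The two roots halve the vertex set up to rounding on the bottom level.\<close>

lemma shared_0_le:
  assumes "e = 1"
  shows "shared 0 \<le> real (card V) ^ 2 / 2 + 2 * real (card V) + 2"
proof -
  have "real (card (desc w)) \<le> real (card V) / 2 + 1" if "w \<in> level 0" for w
  proof -
    have "(\<Sum>i=0..<r. real (K i) / 2) + real (K r) / 2 = real (card V) / 2"
      by (simp add: card_V atLeast0LessThan sum_divide_distrib add_divide_distrib flip: lessThan_Suc_atMost)
    then show ?thesis using card_desc_le[OF _ that] r assms K0 by simp
  qed
  then have "shared 0 \<le> real (K 0) * (real (card V) / 2 + 1) ^ 2"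
    by (rule shared_le[of 0, simplified])
  then show ?thesis using assms K0 by (simp add: power2_eq_square algebra_simps)
qed

text \<open>By \<open>K_le\<close> each level above the bottom contributes at most 2 descendants, so
  squaring perturbs \<open>K r / K l\<close> only by terms linear in the order.\<close>

lemma shared_inner_le:
  assumes "1 \<le> l" "l < r"
  shows "shared l \<le> real (card V) ^ 2 / real (K l) + 3 * (2 * real r + 1) ^ 2 * real (card V)"
proof -
  let ?n = "real (card V)" and ?c = "2 * real r + 1"
  have Kl: "0 < real (K l)" using K_pos[of l] assms by simp
  have le_n: "real (K i) \<le> ?n" if "i \<le> r" for i
    unfolding card_V using that by (intro of_nat_mono member_le_sum) auto
  have "real (card (desc w)) \<le> real (K r) / real (K l) + ?c" if "w \<in> level l" for w
  proof -
    have "real (K i) / real (K l) \<le> 2" if "i \<in> {l..<r}" for i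
    proof -
      have "real (K i) \<le> real (2 * K l)" using K_le[of l i] assms that by (intro of_nat_mono) auto
      then show ?thesis using Kl by (simp add: divide_le_eq)
    qed
    then have "(\<Sum>i=l..<r. real (K i) / real (K l)) \<le> real (card {l..<r}) * 2"
      by (intro sum_bounded_above) auto
    also have "\<dots> \<le> 2 * real r" by simp
    finally show ?thesis using card_desc_le[OF assms(2) that] by simp
  qed
  then have "shared l \<le> real (K l) * (real (K r) / real (K l) + ?c) ^ 2"
    using assms by (intro shared_le) auto
  also have "\<dots> = real (K r) ^ 2 / real (K l) + 2 * (real (K r) * ?c) + real (K l) * ?c ^ 2"
    using Kl by (simp add: power2_eq_square field_simps)
  also have "\<dots> \<le> ?n ^ 2 / real (K l) + 2 * (?n * ?c ^ 2) + ?n * ?c ^ 2"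
  proof (intro add_mono mult_left_mono mult_mono divide_right_mono power_mono)
    show "?c \<le> ?c ^ 2" by (intro self_le_power) auto
  qed (use le_n assms in auto)
  finally show ?thesis by (simp add: algebra_simps)
qed

text \<open>In the linear term, \<open>2 * r\<close> is the depth deficit of the roots, 3 comes from
  rounding at the roots (2) and from the bottom level (1), and the rest from rounding on the inner
  levels.\<close>

lemma wiener_index_ge:
  "(real r + real e / 4) * real (card V) ^ 2
     - real (card V) * (\<Sum>j=1..<r. real (K j) * (real r - real j))
     - real (card V) ^ 2 * (\<Sum>l=1..<r. 1 / real (K l))
     - (2 * real r + 3 + 3 * real r * (2 * real r + 1) ^ 2) * real (card V)
   \<le> real (wiener_index tgraph)"
proof -
  let ?n = "real (card V)" and ?c = "3 * (2 * real r + 1) ^ 2"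
  have roots: "card (level 0) = 1 + e" using card_level[of 0] K0 by simp
  interpret T: tree_graph tgraph using is_tree_tgraph_roots[OF roots e] by (simp add: is_tree_iff)
  have "1 \<le> card V" using card_V K0 by (simp add: sum.atMost_shift)
  then have n1: "1 \<le> ?n" by simp
  have "real (2 * wiener_index tgraph) = (\<Sum>u\<in>V. \<Sum>v\<in>V. real (gdist tgraph u v))"
    unfolding double_wiener_index[OF T.connected_graph_axioms] by simp
  also have "\<dots> = (\<Sum>u\<in>V. \<Sum>v\<in>V. tdist u v)"
    by (intro sum.cong refl gdist_tgraph[OF roots e])
  finally have W: "2 * real (wiener_index tgraph) = (\<Sum>u\<in>V. \<Sum>v\<in>V. tdist u v)" by simp

  have "(\<Sum>j<r. real (card (level j)) * (real r - real j)) = (\<Sum>j<r. real (K j) * (real r - real j))"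
    by (intro sum.cong) (auto simp: card_level)
  also have "\<dots> = real (K 0) * real r + (\<Sum>j=1..<r. real (K j) * (real r - real j))"
    using r by (simp add: sum.atLeast_Suc_lessThan flip: atLeast0LessThan)
  also have "\<dots> \<le> 2 * real r + (\<Sum>j=1..<r. real (K j) * (real r - real j))"
    using K0 e by (intro add_right_mono mult_right_mono) auto
  finally have depth: "(\<Sum>j<r. real (card (level j)) * (real r - real j))
    \<le> 2 * real r + (\<Sum>j=1..<r. real (K j) * (real r - real j))" .

  have root_term: "real e * ?n ^ 2 / 2 - 4 * ?n \<le> real e * (?n ^ 2 - shared 0)"
  proof (cases "e = 0")
    case False
    then have "e = 1" using e by simp
    then show ?thesis using shared_0_le n1 by simp
  qed simp

  have "(\<Sum>i=1..r. shared i) = (\<Sum>i=1..<r. shared i) + shared r"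
    using r by (simp add: sum.last_plus)
  also have "\<dots> \<le> (\<Sum>i=1..<r. ?n ^ 2 / real (K i) + ?c * ?n) + ?n"
    using shared_inner_le shared_r_le by (intro add_mono sum_mono) auto
  also have "\<dots> = ?n ^ 2 * (\<Sum>i=1..<r. 1 / real (K i)) + real (r - 1) * (?c * ?n) + ?n"
    by (simp add: sum.distrib sum_distrib_left)
  also have "\<dots> \<le> ?n ^ 2 * (\<Sum>i=1..<r. 1 / real (K i)) + real r * (?c * ?n) + ?n"
    by (intro add_right_mono add_left_mono mult_right_mono) auto
  finally have sharing: "(\<Sum>i=1..r. shared i)
    \<le> ?n ^ 2 * (\<Sum>i=1..<r. 1 / real (K i)) + real r * (?c * ?n) + ?n" .

  have "?n * (\<Sum>j<r. real (card (level j)) * (real r - real j))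
      \<le> ?n * (2 * real r + (\<Sum>j=1..<r. real (K j) * (real r - real j)))"
    using depth by (intro mult_left_mono) auto
  then show ?thesis
    using W root_term sharing unfolding sum_tdist sum_dep
    by (simp add: algebra_simps power2_eq_square)
qed

text \<open>The bottom vertices numbered 0 and 1 lie in different residue classes modulo every
  \<open>K l\<close> that is at least 2.\<close>

lemma gdiameter_mod_tree: "gdiameter tgraph = 2 * r + e"
proof (rule gdiameter_tgraph)
  let ?u = "prod_encode (r, 0)" and ?v = "prod_encode (r, 1)"
  show "card (level 0) = 1 + e" using card_level[of 0] K0 by simp
  show uv: "?u \<in> V" "?v \<in> V" using K_ge[of r] r by (auto simp: V_iff)
  have apart: "\<not> share l ?u ?v" if "l \<le> r" "2 \<le> K l" for l
  proof (cases "l = r")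
    case True
    then show ?thesis using anc_self[of ?u] anc_self[of ?v] by (simp add: share_def)
  next
    case False
    then have "idx (anc l ?u) \<noteq> idx (anc l ?v)" using idx_anc[OF uv(1), of l] idx_anc[OF uv(2), of l] that by simp
    then show ?thesis by (auto simp: share_def)
  qed
  show "\<not> share 1 ?u ?v" using apart K_ge r by simp
  show "\<not> share 0 ?u ?v" if "0 < e" using apart[of 0] K0 that by simp
qed (use e in auto)

lemma max_wiener_index_ge: "wiener_index tgraph \<le> max_wiener_index (card V) (2 * r + e)"
proof -
  have "is_tree tgraph" using is_tree_tgraph_roots card_level[of 0] K0 e by simp
  then show ?thesis
    unfolding max_wiener_index_def using gdiameter_mod_tree
    by (intro Max_ge finite_wiener_indices CollectI exI[of _ tgraph]) auto
qed

end

section \<open>Asymptotics\<close>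

lemma sum_diff_upt:
  "a \<le> r \<Longrightarrow> (\<Sum>j=a..<r. real r - real j) = (real r - real a + 1) * (real r - real a) / 2"
proof (induction r rule: dec_induct)
  case (step r)
  have "(\<Sum>j=a..<Suc r. real (Suc r) - real j) = (\<Sum>j=a..<r. real r - real j) + (real (r - a) + 1)"
    using step(1) by (simp add: sum.distrib algebra_simps sum_subtractf)
  then show ?case using step by (simp add: of_nat_diff field_simps)
qed simp

lemma max_wiener_index_lower:
  fixes r e n :: nat
  assumes r: "1 \<le> r" and e: "e \<le> 1" and n: "7 * real r + 9 \<le> sqrt (real n)"
  shows "(real r + real e / 4) * real n ^ 2 - 49 / 36 * (real r * sqrt r) * (real n * sqrt n)
     - (2 * real r + 3 + 3 * real r * (2 * real r + 1) ^ 2 + 10 / 9 * real r ^ 2) * real n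
   \<le> real (max_wiener_index n (2 * r + e))"
proof -
  define T where "T = 2 * r div 3"
  define \<kappa> where "\<kappa> = 6 / 5 / sqrt r"
  \<comment> \<open>Inner levels get \<open>2 * k\<close> or \<open>4 * k\<close> vertices, so their
    sizes are divisible by the number of roots, 1 or 2.\<close>
  define k where "k = nat \<lceil>\<kappa> * sqrt n / 2\<rceil>"
  define L where "L i = (if i = 0 then 1 + e else if i \<le> T then 2 * k else 4 * k)" for i
  define K where "K i = (if i < r then L i else n - (\<Sum>i<r. L i))" for i
  have T: "T < r" "real T \<le> 2 * real r / 3" "2 * real r / 3 - 2 / 3 \<le> real T"
    using r unfolding T_def by linarith+
  have sr: "1 \<le> sqrt r" "sqrt r * sqrt r = real r" using r by auto
  have "1 \<le> sqrt n" using n by linarith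
  then have sn: "1 \<le> sqrt n" "sqrt n * sqrt n = real n" by auto
  have \<kappa>: "0 < \<kappa>" "\<kappa> \<le> 6 / 5" using sr by (auto simp: \<kappa>_def field_simps)
  have \<kappa>n: "0 < \<kappa> * sqrt n" using \<kappa> sn by (intro mult_pos_pos) auto
  have k: "\<kappa> * sqrt n \<le> 2 * real k" "2 * real k \<le> \<kappa> * sqrt n + 2" "1 \<le> k"
    using \<kappa>n unfolding k_def by linarith+
  \<comment> \<open>The levels above the bottom use at most \<open>7 * r * sqrt n\<close> vertices,
    so the subtraction defining \<open>K r\<close> does not truncate and almost all vertices remain
    for the bottom when \<open>n\<close> is large.\<close>
  have "(\<Sum>i<r. L i) \<le> (\<Sum>i<r. 4 * k)"
    using e k by (intro sum_mono) (auto simp: L_def)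
  then have "real (\<Sum>i<r. L i) \<le> real (r * (4 * k))" by (intro of_nat_mono) simp
  also have "\<dots> = 2 * real r * (2 * real k)" by simp
  also have "\<dots> \<le> 2 * real r * (6 / 5 * sqrt n + 2)"
  proof -
    have "\<kappa> * sqrt n \<le> 6 / 5 * sqrt n" using \<kappa> sn by (intro mult_right_mono) auto
    then have "2 * real k \<le> 6 / 5 * sqrt n + 2" using k by linarith
    then show ?thesis by (intro mult_left_mono) auto
  qed
  also have "\<dots> \<le> 7 * real r * sqrt n"
  proof -
    have "real r * 1 \<le> real r * sqrt n" using sn by (intro mult_left_mono) auto
    then show ?thesis by (simp add: algebra_simps)
  qed
  also have "\<dots> \<le> real n - 9"
  proof -
    have "(7 * real r + 9) * sqrt n \<le> sqrt n * sqrt n" using n sn by (intro mult_right_mono) auto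
    then have "7 * real r * sqrt n + 9 * sqrt n \<le> real n"
      unfolding sn(2) by (simp only: distrib_right)
    then show ?thesis using sn(1) by linarith
  qed
  finally have small: "(\<Sum>i<r. L i) + 9 \<le> n" by linarith

  interpret mod_tree K r e
  proof
    show "K 0 = 1 + e" using r by (simp add: K_def L_def)
    show "K i dvd K j" if "i \<le> j" "j < r" for i j
    proof -
      have "e = 0 \<or> e = 1" using e by auto
      then have "(1 + e) dvd 2" by (auto simp: numeral_2_eq_2)
      then have "(1 + e) dvd 2 * k" "(1 + e) dvd 4 * k" "2 * k dvd 4 * k"
        by (auto intro: dvd_trans[of _ 2])
      then show ?thesis using that unfolding K_def L_def by (simp split: if_splits)
    qed
    show "2 \<le> K i" if "1 \<le> i" "i \<le> r" for i
      using that k small by (auto simp: K_def L_def)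
    show "K j \<le> 2 * K i" if "1 \<le> i" "i \<le> j" "j < r" for i j
      using that by (auto simp: K_def L_def)
  qed (use r e in auto)

  have "card V = (\<Sum>i<r. K i) + K r" unfolding card_V by (simp flip: lessThan_Suc_atMost)
  also have "(\<Sum>i<r. K i) = (\<Sum>i<r. L i)" by (intro sum.cong) (auto simp: K_def)
  also have "K r = n - (\<Sum>i<r. L i)" by (simp add: K_def)
  finally have cV: "card V = n" using small by simp

  \<comment> \<open>The reciprocal of \<open>2 * k\<close> is written as two copies of that of
    \<open>4 * k\<close>, so the levels up to \<open>T\<close> are counted twice.\<close>
  have "(\<Sum>l=1..<r. 1 / real (K l)) = (\<Sum>l=1..<r. 1 / (4 * real k) + (if l \<le> T then 1 / (4 * real k) else 0))"
    using k by (intro sum.cong) (auto simp: K_def L_def)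
  also have "\<dots> = real (r - 1) / (4 * real k) + (\<Sum>l=1..<r. if l \<le> T then 1 / (4 * real k) else 0)"
    by (simp add: sum.distrib)
  also have "(\<Sum>l=1..<r. if l \<le> T then 1 / (4 * real k) else 0) = (\<Sum>l=1..T. 1 / (4 * real k))"
    using T by (intro sum.mono_neutral_cong_right) auto
  also have "real (r - 1) / (4 * real k) + \<dots> = (real (r - 1) + real T) / (4 * real k)"
    by (simp add: add_divide_distrib)
  also have "\<dots> \<le> (5 / 3 * real r) / (4 * real k)"
    using T r by (intro divide_right_mono) auto
  also have "\<dots> \<le> (5 / 3 * real r) / (2 * (\<kappa> * sqrt n))"
    using k \<kappa>n by (intro divide_left_mono) auto
  finally have "real n ^ 2 * (\<Sum>l=1..<r. 1 / real (K l)) \<le> real n ^ 2 * ((5 / 3 * real r) / (2 * (\<kappa> * sqrt n)))"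
    by (intro mult_left_mono) auto
  also have "\<dots> = 25 / 36 * (real r * sqrt r) * (real n * sqrt n)"
  proof -
    have "real n ^ 2 = real n * sqrt n * sqrt n" using sn by (simp add: power2_eq_square mult.assoc)
    then show ?thesis using sn sr unfolding \<kappa>_def by (simp add: field_simps)
  qed
  finally have share: "real n ^ 2 * (\<Sum>l=1..<r. 1 / real (K l)) \<le> 25 / 36 * (real r * sqrt r) * (real n * sqrt n)" .

  \<comment> \<open>Dually, a size \<open>4 * k\<close> is two copies of \<open>2 * k\<close>, and
    the levels beyond \<open>T\<close> are counted twice.\<close>
  have "(\<Sum>j=1..<r. real (K j) * (real r - real j))
      = (\<Sum>j=1..<r. 2 * real k * (real r - real j) + (if T < j then 2 * real k * (real r - real j) else 0))"
    by (intro sum.cong) (auto simp: K_def L_def)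
  also have "\<dots> = 2 * real k * (\<Sum>j=1..<r. real r - real j)
      + (\<Sum>j=1..<r. if T < j then 2 * real k * (real r - real j) else 0)"
    by (simp add: sum.distrib sum_distrib_left)
  also have "(\<Sum>j=1..<r. if T < j then 2 * real k * (real r - real j) else 0)
      = (\<Sum>j=Suc T..<r. 2 * real k * (real r - real j))"
    by (intro sum.mono_neutral_cong_right) auto
  also have "\<dots> = 2 * real k * (\<Sum>j=Suc T..<r. real r - real j)"
    by (simp add: sum_distrib_left)
  also have "2 * real k * (\<Sum>j=1..<r. real r - real j) + \<dots>
      = real k * (real r * (real r - 1) + (real r - real T) * (real r - real T - 1))"
  proof -
    have *: "(\<Sum>j=1..<r. real r - real j) = real r * (real r - 1) / 2"
      "(\<Sum>j=Suc T..<r. real r - real j) = (real r - real T) * (real r - real T - 1) / 2"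
      using sum_diff_upt[of 1 r] sum_diff_upt[of "Suc T" r] r T(1) by (simp_all add: algebra_simps)
    show ?thesis unfolding * by (simp add: field_simps)
  qed
  also have "\<dots> \<le> real k * (10 / 9 * real r ^ 2)"
  proof -
    \<comment> \<open>Rounding \<open>T\<close> down costs terms linear in \<open>r\<close>, which
      the negative linear term of \<open>r * (r - 1)\<close> outweighs.\<close>
    have "(real r - real T) * (real r - real T - 1) \<le> (real r / 3 + 2 / 3) * (real r / 3 - 1 / 3)"
    proof -
      define y where "y = real r - real T"
      have y: "1 \<le> y" "y \<le> real r / 3 + 2 / 3"
        using T(1,3) unfolding y_def by (simp_all add: field_simps)
      then have "y * (y - 1) \<le> (real r / 3 + 2 / 3) * (y - 1)"
        by (intro mult_right_mono) auto
      also have "\<dots> \<le> (real r / 3 + 2 / 3) * (real r / 3 - 1 / 3)"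
        using y by (intro mult_left_mono) auto
      finally show ?thesis unfolding y_def .
    qed
    then have "real r * (real r - 1) + (real r - real T) * (real r - real T - 1) \<le> 10 / 9 * real r ^ 2"
      using r by (simp add: algebra_simps power2_eq_square)
    then show ?thesis by (intro mult_left_mono) auto
  qed
  \<comment> \<open>The 2 allows for rounding \<open>k\<close> up and yields the summand
    \<open>10 / 9 * r ^ 2 * n\<close>.\<close>
  also have "\<dots> \<le> ((\<kappa> * sqrt n + 2) / 2) * (10 / 9 * real r ^ 2)"
    using k by (intro mult_right_mono) auto
  finally have "real n * (\<Sum>j=1..<r. real (K j) * (real r - real j))
      \<le> real n * (((\<kappa> * sqrt n + 2) / 2) * (10 / 9 * real r ^ 2))"
    by (intro mult_left_mono) auto
  also have "\<dots> = 2 / 3 * (real r * sqrt r) * (real n * sqrt n) + 10 / 9 * real r ^ 2 * real n"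
  proof -
    have "real r ^ 2 = real r * sqrt r * sqrt r" using sr by (simp add: power2_eq_square mult.assoc)
    then have "\<kappa> * real r ^ 2 = 6 / 5 * (real r * sqrt r)" using sr unfolding \<kappa>_def by simp
    moreover have "real n * (((\<kappa> * sqrt n + 2) / 2) * (10 / 9 * real r ^ 2))
      = 5 / 9 * (\<kappa> * real r ^ 2) * (real n * sqrt n) + 10 / 9 * real r ^ 2 * real n"
      by (simp add: field_simps)
    ultimately show ?thesis by simp
  qed
  finally have depth: "real n * (\<Sum>j=1..<r. real (K j) * (real r - real j))
    \<le> 2 / 3 * (real r * sqrt r) * (real n * sqrt n) + 10 / 9 * real r ^ 2 * real n" .

  have "real (wiener_index tgraph) \<le> real (max_wiener_index n (2 * r + e))"
    using max_wiener_index_ge unfolding cV by simp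
  then show ?thesis
    using wiener_index_ge share depth unfolding cV by (simp add: algebra_simps)
qed

text \<open>This makes the set under the maximum nonempty. Two vertices on each inner level use
  \<open>d - 1\<close> vertices above the bottom, which leaves at least two for the bottom.\<close>

lemma ex_tree:
  fixes r e n :: nat
  assumes "1 \<le> r" "e \<le> 1" "2 * r + e < n"
  shows "\<exists>G :: nat pair_pre_digraph. is_tree G \<and> card (pverts G) = n \<and> gdiameter G = 2 * r + e"
proof -
  define L where "L i = (if i = 0 then 1 + e else 2)" for i :: nat
  define K where "K i = (if i < r then L i else n - (\<Sum>i<r. L i))" for i
  have "(\<Sum>i<r. L i) = 1 + e + 2 * (r - 1)"
    using assms(1) by (induction r rule: dec_induct) (auto simp: L_def)
  then have small: "(\<Sum>i<r. L i) + 2 \<le> n" using assms by simp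
  interpret mod_tree K r e
  proof
    show "K i dvd K j" if "i \<le> j" "j < r" for i j
    proof -
      have "e = 0 \<or> e = 1" using assms(2) by auto
      then have "(1 + e) dvd 2" by (auto simp: numeral_2_eq_2)
      then show ?thesis using that by (auto simp: K_def L_def)
    qed
  qed (use assms small in \<open>auto simp: K_def L_def\<close>)
  have "card V = (\<Sum>i<r. K i) + K r" unfolding card_V by (simp flip: lessThan_Suc_atMost)
  also have "(\<Sum>i<r. K i) = (\<Sum>i<r. L i)" by (intro sum.cong) (auto simp: K_def)
  also have "K r = n - (\<Sum>i<r. L i)" by (simp add: K_def)
  finally have "card V = n" using small by simp
  moreover have "is_tree tgraph" using is_tree_tgraph_roots card_level[of 0] K0 e by simp
  ultimately show ?thesis using gdiameter_mod_tree pverts_tgraph by metis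
qed

lemma max_wiener_index_upper:
  assumes "1 \<le> r" "e \<le> 1" "2 * r + e < n" "4 * r ^ 4 \<le> n"
  shows "real (max_wiener_index n (2 * r + e)) \<le> (real r + real e / 4) * real n ^ 2
    - 2 * real n * sqrt n * (\<Sum>i=1..<r. sqrt (real r - real i)) + 4 * real r ^ 3 * real n"
proof -
  let ?S = "{wiener_index G | G :: nat pair_pre_digraph.
            is_tree G \<and> card (pverts G) = n \<and> gdiameter G = 2 * r + e}"
  have "max_wiener_index n (2 * r + e) \<in> ?S"
    unfolding max_wiener_index_def using ex_tree[OF assms(1-3)]
    by (intro Max_in finite_wiener_indices) blast
  then obtain G :: "nat pair_pre_digraph" where G: "is_tree G" "card (pverts G) = n" "gdiameter G = 2 * r + e"
    "max_wiener_index n (2 * r + e) = wiener_index G" by blast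
  show ?thesis
    unfolding G(4) using G assms by (intro wiener_index_le) auto
qed

section \<open>Numerical estimates and passage to the limit\<close>

text \<open>The main term is the integral of the square root from 0 to \<open>r\<close>, less one
  value at the end point because the sum stops before \<open>sqrt r\<close>.\<close>

lemma sum_sqrt_ge:
  "2 / 3 * (real r * sqrt r) - sqrt r \<le> (\<Sum>i=1..<r. sqrt (real r - real i))"
proof -
  have "(\<Sum>i=1..<r. sqrt (real r - real i)) = (\<Sum>j=1..<r. sqrt (real j))"
    by (rule sum.reindex_bij_witness[of _ "\<lambda>j. r - j" "\<lambda>i. r - i"]) (auto simp: of_nat_diff)
  moreover have "2 / 3 * (real r * sqrt r) - sqrt r \<le> (\<Sum>j=1..<r. sqrt (real j))"
  proof (induction r)
    case (Suc r)
    \<comment> \<open>Squared, this is \<open>4 * r ^ 3 - 3 * r + 1 \<le> 4 * r ^ 3\<close>.\<close>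
    have "(2 * real r - 1) * sqrt (real r + 1) \<le> 2 * real r * sqrt r"
    proof (cases "r = 0")
      case False
      have "(2 * real r - 1) ^ 2 * (real r + 1) \<le> (2 * real r) ^ 2 * real r"
        using False by (simp add: power2_eq_square algebra_simps)
      then have "sqrt ((2 * real r - 1) ^ 2 * (real r + 1)) \<le> sqrt ((2 * real r) ^ 2 * real r)"
        by (rule real_sqrt_le_mono)
      then show ?thesis using False by (simp add: real_sqrt_mult)
    qed simp
    then have "2 / 3 * (real (Suc r) * sqrt (real (Suc r))) - sqrt (real (Suc r))
        \<le> 2 / 3 * (real r * sqrt r)" by (simp add: algebra_simps)
    also have "\<dots> \<le> (\<Sum>j=1..<r. sqrt (real j)) + sqrt r" using Suc by simp
    also have "\<dots> \<le> (\<Sum>j=1..<Suc r. sqrt (real j))" by (cases "r = 0") auto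
    finally show ?case .
  qed simp
  ultimately show ?thesis by simp
qed

text \<open>Squaring removes the roots and leaves \<open>(49/36)^2 / 8 \<le> (29/60)^2\<close>,
  about 0.2316 against 0.2336.\<close>

lemma lower_coefficient:
  assumes "2 * real r \<le> d"
  shows "49 / 36 * (real r * sqrt r) \<le> 29 / 60 * (d * sqrt d)"
proof -
  have d: "0 \<le> d" using assms by (meson of_nat_0_le_iff order_trans mult_nonneg_nonneg zero_le_numeral)
  have "(49 / 36 * (real r * sqrt r)) ^ 2 = (49 / 36) ^ 2 * (real r ^ 3)"
    by (simp add: power_mult_distrib power2_eq_square power3_eq_cube)
  also have "\<dots> \<le> (49 / 36) ^ 2 * ((d / 2) ^ 3)"
    using assms by (intro mult_left_mono power_mono) auto
  also have "\<dots> \<le> (29 / 60) ^ 2 * d ^ 3"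
    using d by (simp add: power_divide)
  also have "\<dots> = (29 / 60 * (d * sqrt d)) ^ 2"
    using d by (simp add: power_mult_distrib power2_eq_square power3_eq_cube)
  finally show ?thesis by (rule power2_le_imp_le) (use d in auto)
qed

text \<open>The left main term is \<open>4/3 * (d / 2)^(3/2)\<close>. Replacing \<open>d / 2\<close>
  by \<open>r\<close> costs at most \<open>sqrt d\<close>, and the end correction of
  \<open>sum_sqrt_ge\<close>, doubled, at most \<open>2 * sqrt d\<close>.\<close>

lemma upper_coefficient:
  assumes d: "2 * real r \<le> d" "d \<le> 2 * real r + 1"
  shows "sqrt 2 / 3 * (d * sqrt d) - 3 * sqrt d \<le> 2 * (\<Sum>i=1..<r. sqrt (real r - real i))"
proof -
  define x where "x = sqrt r"
  define y where "y = sqrt (d / 2)"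
  have d0: "0 \<le> d" using d by (meson of_nat_0_le_iff order_trans mult_nonneg_nonneg zero_le_numeral)
  have x: "0 \<le> x" "x ^ 2 = real r" by (auto simp: x_def)
  have y: "0 \<le> y" "y ^ 2 = d / 2" using d0 by (auto simp: y_def)
  have xy: "x \<le> y" "y \<le> sqrt d" unfolding x_def y_def using d d0 by auto
  have sd: "sqrt d = sqrt 2 * y" by (simp add: y_def real_sqrt_divide)
  have "sqrt 2 / 3 * (d * sqrt d) = 4 / 3 * y ^ 3"
  proof -
    have "sqrt 2 / 3 * (d * sqrt d) = sqrt 2 * sqrt 2 / 3 * (2 * y ^ 2) * y"
      unfolding sd y(2) by simp
    then show ?thesis by (simp add: power2_eq_square power3_eq_cube)
  qed
  moreover have "y ^ 3 - x ^ 3 \<le> 3 / 4 * y"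
  proof -
    have "y ^ 3 - x ^ 3 = (y - x) * (y ^ 2 + x * y + x ^ 2)"
      by (simp add: power2_eq_square power3_eq_cube algebra_simps)
    \<comment> \<open>The factor \<open>y + x\<close> is split off because only the difference of
      squares, at most 1/2, is controlled.\<close>
    also have "\<dots> \<le> (y - x) * (3 / 2 * y * (y + x))"
    proof (intro mult_left_mono)
      have "x * x \<le> y * y" "x * x \<le> x * y" using x y xy by (auto intro: mult_mono)
      then show "y ^ 2 + x * y + x ^ 2 \<le> 3 / 2 * y * (y + x)"
        by (simp add: power2_eq_square algebra_simps)
    qed (use xy in simp)
    also have "\<dots> = 3 / 2 * y * (y ^ 2 - x ^ 2)" by (simp add: power2_eq_square algebra_simps)
    also have "\<dots> \<le> 3 / 2 * y * (1 / 2)"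
      using x y d by (intro mult_left_mono) auto
    finally show ?thesis by simp
  qed
  moreover have "2 / 3 * x ^ 3 - x \<le> (\<Sum>i=1..<r. sqrt (real r - real i))"
  proof -
    have "x ^ 3 = real r * sqrt r" by (simp add: power3_eq_cube x_def)
    then show ?thesis using sum_sqrt_ge[of r] unfolding x_def by simp
  qed
  ultimately show ?thesis using xy by linarith
qed

lemma powr_three_halves: "0 \<le> x \<Longrightarrow> x powr (3 / 2) = x * sqrt (x::real)"
proof -
  assume x: "0 \<le> x"
  have "x powr (3 / 2) = x powr (1 + 1 / 2)" by simp
  also have "\<dots> = x powr 1 * x powr (1 / 2)" by (rule powr_add)
  finally show ?thesis using x by (simp add: powr_half_sqrt)
qed

text \<open>Both parities at once: \<open>r + e / 4\<close> is \<open>d / 2\<close> for even and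
  \<open>(d - 0.5) / 2\<close> for odd \<open>d\<close>. The summands \<open>0\<close> and
  \<open>- 3 * sqrt d\<close> stay visible as the instances of the two correction functions.\<close>

lemma max_wiener_index_asymp:
  assumes "2 \<le> d" "r = d div 2" "e = d mod 2"
  shows "\<exists>s t :: nat \<Rightarrow> real. s \<in> O(\<lambda>n. real n) \<and> t \<in> O(\<lambda>n. real n) \<and>
    (\<forall>\<^sub>F n in sequentially.
       (real r + real e / 4) * real n ^ 2 - (29/60 * real d powr (3/2) + 0) * real n powr (3/2) + s n
         \<le> real (max_wiener_index n d) \<and>
       real (max_wiener_index n d) \<le> (real r + real e / 4) * real n ^ 2
         - (sqrt 2 / 3 * real d powr (3/2) + - 3 * sqrt (real d)) * real n powr (3/2) + t n)"
proof -
  have d: "d = 2 * r + e" and r: "1 \<le> r" and e: "e \<le> 1" using assms by auto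
  have rd: "2 * real r \<le> real d" "real d \<le> 2 * real r + 1" using d e by auto
  define C where "C = 2 * real r + 3 + 3 * real r * (2 * real r + 1) ^ 2 + 10 / 9 * real r ^ 2"
  have "\<forall>\<^sub>F n in sequentially. 7 * real r + 9 \<le> sqrt (real n)"
    by (intro filterlim_at_top[THEN iffD1, rule_format]
        filterlim_compose[OF sqrt_at_top filterlim_real_sequentially])
  moreover have "\<forall>\<^sub>F n in sequentially. 2 * r + e < n" by (rule eventually_gt_at_top)
  moreover have "\<forall>\<^sub>F n in sequentially. 4 * r ^ 4 \<le> n" by (rule eventually_ge_at_top)
  ultimately have "\<forall>\<^sub>F n in sequentially.
       (real r + real e / 4) * real n ^ 2 - (29/60 * real d powr (3/2) + 0) * real n powr (3/2) + - C * real n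
         \<le> real (max_wiener_index n d) \<and>
       real (max_wiener_index n d) \<le> (real r + real e / 4) * real n ^ 2
         - (sqrt 2 / 3 * real d powr (3/2) + - 3 * sqrt (real d)) * real n powr (3/2) + 4 * real r ^ 3 * real n"
  proof eventually_elim
    case (elim n)
    let ?N = "real n * sqrt n"
    have "49 / 36 * (real r * sqrt r) * ?N \<le> 29 / 60 * (real d * sqrt d) * ?N"
      using lower_coefficient[OF rd(1)] by (intro mult_right_mono) auto
    moreover have "(sqrt 2 / 3 * (real d * sqrt d) - 3 * sqrt d) * ?N
        \<le> 2 * (\<Sum>i=1..<r. sqrt (real r - real i)) * ?N"
      using upper_coefficient[OF rd] by (intro mult_right_mono) auto
    ultimately show ?case
      using max_wiener_index_lower[OF r e elim(1)] max_wiener_index_upper[OF r e elim(2,3)]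
      unfolding d[symmetric] C_def[symmetric] by (simp add: powr_three_halves mult_ac)
  qed
  then show ?thesis
    by (intro exI[of _ "\<lambda>n. - C * real n"] exI[of _ "\<lambda>n. 4 * real r ^ 3 * real n"]) simp
qed

theorem theorem4p8:
  shows "(\<exists>\<epsilon> \<delta> :: nat \<Rightarrow> real.
       \<epsilon> \<in> o(\<lambda>d. real d powr (3/2)) \<and> \<delta> \<in> O(\<lambda>d. sqrt (real d)) \<and>
       (\<forall>d\<ge>2. even d \<longrightarrow>
         (\<exists>r s :: nat \<Rightarrow> real. r \<in> O(\<lambda>n. real n) \<and> s \<in> O(\<lambda>n. real n) \<and>
           (\<forall>\<^sub>F n in sequentially.
              real d / 2 * real n ^ 2
                - (29/60 * real d powr (3/2) + \<epsilon> d) * real n powr (3/2) + r n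
                \<le> real (max_wiener_index n d) \<and>
              real (max_wiener_index n d)
                \<le> real d / 2 * real n ^ 2
                  - (sqrt 2 / 3 * real d powr (3/2) + \<delta> d) * real n powr (3/2) + s n))))
    \<and>
    (\<exists>\<epsilon> \<delta> :: nat \<Rightarrow> real.
       \<epsilon> \<in> o(\<lambda>d. real d powr (3/2)) \<and> \<delta> \<in> O(\<lambda>d. sqrt (real d)) \<and>
       (\<forall>d\<ge>2. odd d \<longrightarrow>
         (\<exists>r s :: nat \<Rightarrow> real. r \<in> O(\<lambda>n. real n) \<and> s \<in> O(\<lambda>n. real n) \<and>
           (\<forall>\<^sub>F n in sequentially.
              (real d - 0.5) / 2 * real n ^ 2
                - (29/60 * real d powr (3/2) + \<epsilon> d) * real n powr (3/2) + r n
                \<le> real (max_wiener_index n d) \<and>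
              real (max_wiener_index n d)
                \<le> (real d - 0.5) / 2 * real n ^ 2
                  - (sqrt 2 / 3 * real d powr (3/2) + \<delta> d) * real n powr (3/2) + s n))))"
proof (rule conjI; rule exI[of _ "\<lambda>_. 0"]; rule exI[of _ "\<lambda>d. - 3 * sqrt (real d)"];
    intro conjI allI impI)
  fix d :: nat assume d: "2 \<le> d" "even d"
  then have c: "real d / 2 = real (d div 2) + real (d mod 2) / 4" by auto
  show "\<exists>r s :: nat \<Rightarrow> real. r \<in> O(\<lambda>n. real n) \<and> s \<in> O(\<lambda>n. real n) \<and>
           (\<forall>\<^sub>F n in sequentially.
              real d / 2 * real n ^ 2
                - (29/60 * real d powr (3/2) + 0) * real n powr (3/2) + r n
                \<le> real (max_wiener_index n d) \<and>
              real (max_wiener_index n d)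
                \<le> real d / 2 * real n ^ 2
                  - (sqrt 2 / 3 * real d powr (3/2) + - 3 * sqrt (real d)) * real n powr (3/2) + s n)"
    unfolding c by (rule max_wiener_index_asymp[OF d(1) refl refl])
next
  fix d :: nat assume d: "2 \<le> d" "odd d"
  then have c: "(real d - 0.5) / 2 = real (d div 2) + real (d mod 2) / 4"
    by (auto elim!: oddE)
  show "\<exists>r s :: nat \<Rightarrow> real. r \<in> O(\<lambda>n. real n) \<and> s \<in> O(\<lambda>n. real n) \<and>
           (\<forall>\<^sub>F n in sequentially.
              (real d - 0.5) / 2 * real n ^ 2
                - (29/60 * real d powr (3/2) + 0) * real n powr (3/2) + r n
                \<le> real (max_wiener_index n d) \<and>
              real (max_wiener_index n d)
                \<le> (real d - 0.5) / 2 * real n ^ 2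
                  - (sqrt 2 / 3 * real d powr (3/2) + - 3 * sqrt (real d)) * real n powr (3/2) + s n)"
    unfolding c by (rule max_wiener_index_asymp[OF d(1) refl refl])
qed simp_all

end
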